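(* Let $X$ be an infinite, connected, locally finite, vertex-transitive graph with root $o$, and let $(X_n)$ be a sequence of finite rooted graphs (not necessarily subgraphs of $X$) converging to $X$. If $(X_n)$ is a Følner approximation of $X$, then the cumulative spectral measures $\tilde\mu_n$ of $X_n$ converge weakly to the Plancherel measure of $X$.
   Context: For a graph in which every vertex has at least one and finitely many neighbours, simple random walk (SRW) has transition probabilities $p(x,y)=1/\deg(x)$ if $y\sim x$ and $0$ otherwise. $P$ is the SRW operator on $X$, self-adjoint on $\ell^2(X)$. The Plancherel measure of $X$ is the probability measure $\mu_{o,o}(d\lambda)=\langle\delta_o,E(d\lambda)\delta_o\rangle$, with $E$ the resolution of the identity of $P$; it does not depend on $o$, and its $N$-th moment is the return probability $p^{(N)}(o,o)$. Every vertex of $X_n$ is assumed to have a neighbour in $X_n$, so that SRW on $X_n$, with operator $P_n$, is defined. The cumulative spectral measure is $\tilde\mu_n=\frac1{|X_n|}\sum_{\lambda\in\mathrm{spec}(P_n)}\mathrm{mult}(\lambda)\,\delta_\lambda$, where $\mathrm{mult}(\lambda)$ is the multiplicity of $\lambda$ as an eigenvalue of $P_n$. Convergence: rooted graphs $(X_n,o_n)$ converge to $(X,o)$ if the largest radius $R$ for which there is a root-preserving isomorphism between the balls $B_X(o,R)$ and $B_{X_n}(o_n,R)$ (in the graph metrics) tends to $\infty$. Følner approximation: for $N\in\mathbb N$ let $\partial^N X_n=\{x\in X_n: B_{X_n}(x,N/2)\text{ is not isomorphic with } B_X(o,N/2)\}$ (isomorphism of balls rooted at their centres). $(X_n)$ is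 a Følner approximation of $X$ if $|\partial^N X_n|/|X_n|\to0$ as $n\to\infty$ for every $N\in\mathbb N$. *)

theory Defs
  imports "HOL-Probability.Probability" "HOL-Library.Function_Algebras"
begin

section \<open>Graphs\<close>

record 'a graph =
  verts :: "'a set"
  edges :: "('a \<times> 'a) set"

text \<open>Undirected graphs without multiple edges, given by a symmetric adjacency relation.
  Loops are not excluded; a vertex with a loop is one of its own neighbours.\<close>

definition is_graph :: "'a graph \<Rightarrow> bool" where
  "is_graph G \<longleftrightarrow> edges G \<subseteq> verts G \<times> verts G \<and> sym (edges G)"

definition nbrs :: "'a graph \<Rightarrow> 'a \<Rightarrow> 'a set" where
  "nbrs G x = {y. (x, y) \<in> edges G}"

definition degree :: "'a graph \<Rightarrow> 'a \<Rightarrow> nat" where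
  "degree G x = card (nbrs G x)"

definition locally_finite :: "'a graph \<Rightarrow> bool" where
  "locally_finite G \<longleftrightarrow> (\<forall>x\<in>verts G. finite (nbrs G x))"

definition no_isolated :: "'a graph \<Rightarrow> bool" where
  "no_isolated G \<longleftrightarrow> (\<forall>x\<in>verts G. nbrs G x \<noteq> {})"

definition connected_graph :: "'a graph \<Rightarrow> bool" where
  "connected_graph G \<longleftrightarrow> (\<forall>x\<in>verts G. \<forall>y\<in>verts G. (x, y) \<in> (edges G)\<^sup>*)"

definition graph_iso :: "('a \<Rightarrow> 'b) \<Rightarrow> 'a graph \<Rightarrow> 'b graph \<Rightarrow> bool" where
  "graph_iso \<phi> G H \<longleftrightarrow> bij_betw \<phi> (verts G) (verts H) \<and>
     (\<forall>x\<in>verts G. \<forall>y\<in>verts G. (x, y) \<in> edges G \<longleftrightarrow> (\<phi> x, \<phi> y) \<in> edges H)"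

definition vertex_transitive :: "'a graph \<Rightarrow> bool" where
  "vertex_transitive G \<longleftrightarrow> (\<forall>x\<in>verts G. \<forall>y\<in>verts G. \<exists>\<phi>. graph_iso \<phi> G G \<and> \<phi> x = y)"

definition rooted_isomorphic :: "'a graph \<Rightarrow> 'a \<Rightarrow> 'b graph \<Rightarrow> 'b \<Rightarrow> bool" where
  "rooted_isomorphic G x H y \<longleftrightarrow> (\<exists>\<phi>. graph_iso \<phi> G H \<and> \<phi> x = y)"

text \<open>The graph metric is \<open>\<infinity>\<close> between different components, because finite
  graphs are not assumed to be connected.\<close>

definition gdist :: "'a graph \<Rightarrow> 'a \<Rightarrow> 'a \<Rightarrow> ereal" where
  "gdist G x y = (INF k\<in>{k::nat. (x, y) \<in> edges G ^^ k}. ereal (real k))"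

definition gball :: "'a graph \<Rightarrow> 'a \<Rightarrow> real \<Rightarrow> 'a graph" where
  "gball G x r =
     (let S = {y \<in> verts G. gdist G x y \<le> ereal r}
      in \<lparr>verts = S, edges = edges G \<inter> S \<times> S\<rparr>)"

section \<open>Convergence of rooted graphs and Foelner approximation\<close>

definition agreement_radius :: "'a graph \<Rightarrow> 'a \<Rightarrow> 'b graph \<Rightarrow> 'b \<Rightarrow> enat" where
  "agreement_radius G x H y =
     (SUP R\<in>{R::nat. rooted_isomorphic (gball G x (real R)) x (gball H y (real R)) y}. enat R)"

definition rooted_converges ::
    "(nat \<Rightarrow> 'b graph) \<Rightarrow> (nat \<Rightarrow> 'b) \<Rightarrow> 'a graph \<Rightarrow> 'a \<Rightarrow> bool" where
  "rooted_converges Xs rs X r \<longleftrightarrow>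
     (\<lambda>n. agreement_radius X r (Xs n) (rs n)) \<longlonglongrightarrow> \<infinity>"

definition bad_verts :: "nat \<Rightarrow> 'b graph \<Rightarrow> 'a graph \<Rightarrow> 'a \<Rightarrow> 'b set" where
  "bad_verts N Y X r =
     {x \<in> verts Y. \<not> rooted_isomorphic (gball Y x (real N / 2)) x (gball X r (real N / 2)) r}"

definition foelner_approximation :: "(nat \<Rightarrow> 'b graph) \<Rightarrow> 'a graph \<Rightarrow> 'a \<Rightarrow> bool" where
  "foelner_approximation Xs X r \<longleftrightarrow>
     (\<forall>N. (\<lambda>n. real (card (bad_verts N (Xs n) X r)) / real (card (verts (Xs n)))) \<longlonglongrightarrow> 0)"

section \<open>Simple random walk\<close>

definition srw :: "'a graph \<Rightarrow> 'a \<Rightarrow> 'a \<Rightarrow> real" where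
  "srw G x y = (if (x, y) \<in> edges G then 1 / real (degree G x) else 0)"

text \<open>Functions on the vertex set are represented by functions on the whole type that vanish
  off \<open>verts G\<close>. The sum below is the full sum \<open>\<Sum>y. p(x,y) f(y)\<close>, as \<open>p(x,y) = 0\<close>
  when \<open>y\<close> is not a neighbour of \<open>x\<close>; it is empty for \<open>x\<close> off \<open>verts G\<close>.\<close>

definition srw_op :: "'a graph \<Rightarrow> ('a \<Rightarrow> complex) \<Rightarrow> ('a \<Rightarrow> complex)" where
  "srw_op G f = (\<lambda>x. \<Sum>y\<in>nbrs G x. complex_of_real (srw G x y) * f y)"

section \<open>Cumulative spectral measure of a finite graph\<close>

definition fscale :: "complex \<Rightarrow> ('a \<Rightarrow> complex) \<Rightarrow> ('a \<Rightarrow> complex)" where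
  "fscale c f = (\<lambda>x. c * f x)"

global_interpretation fun_vs: vector_space "fscale :: complex \<Rightarrow> ('a \<Rightarrow> complex) \<Rightarrow> ('a \<Rightarrow> complex)"
  by unfold_locales (auto simp: fscale_def algebra_simps fun_eq_iff)

definition eigenspace :: "'a graph \<Rightarrow> complex \<Rightarrow> ('a \<Rightarrow> complex) set" where
  "eigenspace G l = {f. (\<forall>x. x \<notin> verts G \<longrightarrow> f x = 0) \<and> srw_op G f = fscale l f}"

definition srw_spec :: "'a graph \<Rightarrow> complex set" where
  "srw_spec G = {l. \<exists>f\<in>eigenspace G l. f \<noteq> 0}"

definition eigen_mult :: "'a graph \<Rightarrow> complex \<Rightarrow> nat" where
  "eigen_mult G l = fun_vs.dim (eigenspace G l)"

text \<open>All eigenvalues are real, since the operator is self-adjoint for the inner product weighted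
  by the degrees; \<open>Re\<close> is only the passage from complex to real numbers.
  The operator is also diagonalisable, so geometric and algebraic multiplicities agree.\<close>

definition cumulative_spectral_measure :: "'a graph \<Rightarrow> real measure" where
  "cumulative_spectral_measure G =
     measure_of UNIV (sets borel)
       (\<lambda>B. ennreal (1 / real (card (verts G)) *
          (\<Sum>l\<in>srw_spec G. real (eigen_mult G l) * indicator B (Re l))))"

section \<open>Resolution of the identity and Plancherel measure\<close>

definition ell2 :: "'a set \<Rightarrow> ('a \<Rightarrow> complex) set" where
  "ell2 V = {f. (\<forall>x. x \<notin> V \<longrightarrow> f x = 0) \<and> (\<lambda>x. (cmod (f x))\<^sup>2) summable_on V}"

definition ell2_inner :: "'a set \<Rightarrow> ('a \<Rightarrow> complex) \<Rightarrow> ('a \<Rightarrow> complex) \<Rightarrow> complex" where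
  "ell2_inner V f g = (\<Sum>\<^sub>\<infinity>x\<in>V. cnj (f x) * g x)"

definition ell2_norm :: "'a set \<Rightarrow> ('a \<Rightarrow> complex) \<Rightarrow> real" where
  "ell2_norm V f = sqrt (\<Sum>\<^sub>\<infinity>x\<in>V. (cmod (f x))\<^sup>2)"

definition delta :: "'a \<Rightarrow> 'a \<Rightarrow> complex" where
  "delta r = (\<lambda>x. if x = r then 1 else 0)"

definition orth_projection :: "'a set \<Rightarrow> (('a \<Rightarrow> complex) \<Rightarrow> ('a \<Rightarrow> complex)) \<Rightarrow> bool" where
  "orth_projection V T \<longleftrightarrow>
     (\<forall>f\<in>ell2 V. T f \<in> ell2 V) \<and>
     (\<forall>f\<in>ell2 V. \<forall>g\<in>ell2 V. T (f + g) = T f + T g) \<and>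
     (\<forall>c. \<forall>f\<in>ell2 V. T (fscale c f) = fscale c (T f)) \<and>
     (\<forall>f\<in>ell2 V. T (T f) = T f) \<and>
     (\<forall>f\<in>ell2 V. \<forall>g\<in>ell2 V. ell2_inner V (T f) g = ell2_inner V f (T g))"

text \<open>The measure \<open>\<langle>f, E(d\<lambda>) f\<rangle>\<close>; the values \<open>\<langle>f, E(B) f\<rangle>\<close> are
  nonnegative reals when \<open>E(B)\<close> is an orthogonal projection.\<close>

definition spectral_measure ::
    "'a set \<Rightarrow> (real set \<Rightarrow> ('a \<Rightarrow> complex) \<Rightarrow> ('a \<Rightarrow> complex)) \<Rightarrow> ('a \<Rightarrow> complex) \<Rightarrow> real measure" where
  "spectral_measure V E f =
     measure_of UNIV (sets borel) (\<lambda>B. ennreal (Re (ell2_inner V f (E B f))))"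

text \<open>Resolution of the identity of a bounded self-adjoint operator \<open>P\<close> on \<open>ell2 V\<close>: a
  projection-valued Borel measure \<open>E\<close> of bounded support with \<open>P = \<integral>\<lambda> E(d\<lambda>)\<close>.
  As usual for bounded self-adjoint operators, the last identity is expressed by quadratic forms
  (it extends to \<open>\<langle>f, P g\<rangle>\<close> by polarisation). By the spectral theorem such an
  \<open>E\<close> exists, and its values on Borel sets, as operators on \<open>ell2 V\<close>, are unique.\<close>

definition resolution_of_identity ::
    "'a set \<Rightarrow> (('a \<Rightarrow> complex) \<Rightarrow> ('a \<Rightarrow> complex)) \<Rightarrow>
     (real set \<Rightarrow> ('a \<Rightarrow> complex) \<Rightarrow> ('a \<Rightarrow> complex)) \<Rightarrow> bool" where
  "resolution_of_identity V P E \<longleftrightarrow>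
     (\<forall>B\<in>sets borel. orth_projection V (E B)) \<and>
     (\<forall>f\<in>ell2 V. E {} f = 0 \<and> E UNIV f = f) \<and>
     (\<exists>a. \<forall>f\<in>ell2 V. E {-a..a} f = f) \<and>
     (\<forall>A\<in>sets borel. \<forall>B\<in>sets borel. \<forall>f\<in>ell2 V. E (A \<inter> B) f = E A (E B f)) \<and>
     (\<forall>A :: nat \<Rightarrow> real set. range A \<subseteq> sets borel \<longrightarrow> disjoint_family A \<longrightarrow>
        (\<forall>f\<in>ell2 V. (\<lambda>n. ell2_norm V (E (\<Union>i. A i) f - (\<Sum>i<n. E (A i) f))) \<longlonglongrightarrow> 0)) \<and>
     (\<forall>f\<in>ell2 V. ell2_inner V f (P f) = complex_of_real (\<integral>l. l \<partial>spectral_measure V E f))"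

definition plancherel_measure ::
    "'a graph \<Rightarrow> (real set \<Rightarrow> ('a \<Rightarrow> complex) \<Rightarrow> ('a \<Rightarrow> complex)) \<Rightarrow> 'a \<Rightarrow> real measure" where
  "plancherel_measure G E r = spectral_measure (verts G) E (delta r)"

end

theory Submission
  imports "HOL-Computational_Algebra.Fundamental_Theorem_Algebra" Defs
begin

text \<open>The proof compares moments. Write \<open>P\<close> for the transition operator of a walk. The \<open>N\<close>-th moment of
  the cumulative spectral measure of a finite graph is the normalised trace of \<open>P ^^ N\<close>, which is the
  average over all vertices \<open>x\<close> of the probability to return to \<open>x\<close> at time \<open>N\<close>. The \<open>N\<close>-th moment of
  the Plancherel measure is the probability to return to the root at time \<open>N\<close>. A closed walk of length
  \<open>N\<close> stays in the ball of radius \<open>N\<close> around its starting point, so the two return probabilities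
  agree at all vertices outside \<open>bad_verts (2 * N)\<close> (\<open>ball_iso_return\<close>); the proportion of the others
  tends to \<open>0\<close>, and hence the moments converge (\<open>mean_return_tendsto\<close>). All measures live on
  one bounded interval, where moments determine weak convergence by the Weierstrass approximation
  theorem (\<open>moments_tendsto_imp_weak_conv_m\<close>).

  The trace formula needs a basis of eigenvectors of the walk on a finite graph. It exists
  (\<open>ex_eigenbasis\<close>) because \<open>P\<close> is self-adjoint for the inner product weighted by the degrees, so the orthogonal
  complement of a set of eigenvectors is invariant and, unless zero, contains a further eigenvector by the fundamental
  theorem of algebra.

  For the Plancherel measure the definition of the resolution of the identity \<open>E\<close> supplies
  only the first moment, \<open>\<langle>f, P f\<rangle> = \<integral>l \<langle>f, E(dl) f\<rangle>\<close>, but for every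
  \<open>f\<close>. Higher moments follow from the multiplicativity of \<open>E\<close>. Applying the formula to the two
  parts \<open>E(B) f\<close> and \<open>E(- B) f\<close> shows that \<open>P\<close> commutes with \<open>E\<close> in the weak sense
  (\<open>E_cross\<close>). Applying it then to \<open>f + t P f\<close> shows that the spectral measure of \<open>P f\<close> has density
  \<open>l\<^sup>2\<close> with respect to that of \<open>f\<close> (\<open>weight_T\<close>), and \<open>moment\<close> follows by induction in steps of two.\<close>

section \<open>Return probabilities only see balls\<close>

lemma gdist_le_nat_iff:
  "gdist G x y \<le> ereal (real j) \<longleftrightarrow> (\<exists>k\<le>j. (x, y) \<in> edges G ^^ k)"
proof
  assume le: "gdist G x y \<le> ereal (real j)"
  show "\<exists>k\<le>j. (x, y) \<in> edges G ^^ k"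
  proof (rule ccontr)
    assume none: "\<not> (\<exists>k\<le>j. (x, y) \<in> edges G ^^ k)"
    have "ereal (real (Suc j)) \<le> gdist G x y"
      unfolding gdist_def
    proof (rule INF_greatest)
      fix k assume "k \<in> {k. (x, y) \<in> edges G ^^ k}"
      with none have "Suc j \<le> k"
        by (auto simp: not_le[symmetric] Suc_le_eq)
      then show "ereal (real (Suc j)) \<le> ereal (real k)"
        by (simp del: of_nat_Suc)
    qed
    with le have "ereal (real (Suc j)) \<le> ereal (real j)"
      by (rule order_trans[rotated])
    then show False
      by simp
  qed
next
  assume "\<exists>k\<le>j. (x, y) \<in> edges G ^^ k"
  then obtain k where k: "k \<le> j" "(x, y) \<in> edges G ^^ k"
    by blast
  have "gdist G x y \<le> ereal (real k)"
    unfolding gdist_def by (rule INF_lower) (use k in simp)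
  also have "\<dots> \<le> ereal (real j)"
    using k by simp
  finally show "gdist G x y \<le> ereal (real j)" .
qed

definition reach :: "'a graph \<Rightarrow> 'a \<Rightarrow> nat \<Rightarrow> 'a set" where
  "reach G x j = {y \<in> verts G. \<exists>k\<le>j. (x, y) \<in> edges G ^^ k}"

lemma gball_nat:
  "gball G x (real j) = \<lparr>verts = reach G x j, edges = edges G \<inter> reach G x j \<times> reach G x j\<rparr>"
  by (simp add: gball_def reach_def gdist_le_nat_iff Let_def)

lemma reach_mono: "i \<le> j \<Longrightarrow> reach G x i \<subseteq> reach G x j"
  unfolding reach_def using le_trans by blast

lemma reach_0: "x \<in> verts G \<Longrightarrow> reach G x 0 = {x}"
  by (auto simp: reach_def)

lemma reach_Suc:
  assumes "is_graph G" "y \<in> reach G x j" "(y, z) \<in> edges G"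
  shows "z \<in> reach G x (Suc j)"
proof -
  obtain k where "k \<le> j" "(x, y) \<in> edges G ^^ k"
    using assms by (auto simp: reach_def)
  then have "Suc k \<le> Suc j" "(x, z) \<in> edges G ^^ Suc k"
    using assms(3) by auto
  moreover have "z \<in> verts G"
    using assms by (auto simp: is_graph_def)
  ultimately show ?thesis
    unfolding reach_def by blast
qed

lemma reach_SucE:
  assumes "is_graph G" "x \<in> verts G" "z \<in> reach G x (Suc j)"
  obtains "z \<in> reach G x j" | y where "y \<in> reach G x j" "(y, z) \<in> edges G"
proof -
  obtain k where k: "k \<le> Suc j" "(x, z) \<in> edges G ^^ k" "z \<in> verts G"
    using assms by (auto simp: reach_def)
  show ?thesis
  proof (cases k)
    case 0
    then show ?thesis using k that(1) unfolding reach_def by blast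
  next
    case (Suc m)
    then obtain y where y: "(x, y) \<in> edges G ^^ m" "(y, z) \<in> edges G"
      using k by auto
    then have "y \<in> reach G x j"
      using assms k Suc by (auto simp: reach_def is_graph_def)
    then show ?thesis using y that(2) by blast
  qed
qed

text \<open>A walk of at most \<open>R\<close> steps from the centre never leaves the ball of radius \<open>R\<close>, so an
  isomorphism of these balls transports it step by step.\<close>

lemma ball_iso_reach:
  assumes G: "is_graph G" "x \<in> verts G" and H: "is_graph H" "y \<in> verts H"
    and iso: "graph_iso \<phi> (gball G x (real R)) (gball H y (real R))" "\<phi> x = y"
    and "j \<le> R" "z \<in> reach G x j"
  shows "\<phi> z \<in> reach H y j"
  using \<open>j \<le> R\<close> \<open>z \<in> reach G x j\<close>
proof (induction j arbitrary: z)
  case 0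
  then show ?case using assms by (simp add: reach_0)
next
  case (Suc j)
  from G Suc.prems(2) show ?case
  proof (cases rule: reach_SucE)
    case 1
    then show ?thesis using Suc reach_mono[of j "Suc j" H y] by auto
  next
    case (2 w)
    have "w \<in> reach G x R" "z \<in> reach G x R"
      using 2 Suc.prems reach_mono[of j R G x] reach_mono[of "Suc j" R G x] by auto
    then have "(\<phi> w, \<phi> z) \<in> edges H"
      using iso 2 by (auto simp: graph_iso_def gball_nat)
    moreover have "\<phi> w \<in> reach H y j"
      using Suc.IH 2 Suc.prems(1) by simp
    ultimately show ?thesis
      using reach_Suc[OF H(1)] by blast
  qed
qed

text \<open>Inside the ball, away from its boundary sphere, the isomorphism sees all neighbours of a
  vertex, so it also preserves the degrees in the ambient graphs.\<close>

lemma ball_iso_nbrs: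
  assumes G: "is_graph G" "x \<in> verts G" and H: "is_graph H" "y \<in> verts H"
    and iso: "graph_iso \<phi> (gball G x (real R)) (gball H y (real R))" "\<phi> x = y"
    and "j < R" "z \<in> reach G x j"
  shows "bij_betw \<phi> (nbrs G z) (nbrs H (\<phi> z))"
proof -
  have inj: "inj_on \<phi> (reach G x R)" and im: "\<phi> ` reach G x R = reach H y R"
    using iso by (auto simp: graph_iso_def gball_nat bij_betw_def)
  have zR: "z \<in> reach G x R"
    using assms(7,8) reach_mono[of j R G x] by auto
  have sub: "nbrs G z \<subseteq> reach G x R"
    using reach_Suc[OF G(1) assms(8)] reach_mono[of "Suc j" R G x] assms(7)
    by (auto simp: nbrs_def)
  have "\<phi> z \<in> reach H y j"
    using ball_iso_reach[OF G H iso _ assms(8)] assms(7) by simp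
  then have subH: "nbrs H (\<phi> z) \<subseteq> reach H y R"
    using reach_Suc[OF H(1)] reach_mono[of "Suc j" R H y] assms(7)
    by (fastforce simp: nbrs_def)
  have edge: "(z, w) \<in> edges G \<longleftrightarrow> (\<phi> z, \<phi> w) \<in> edges H" if "w \<in> reach G x R" for w
    using iso zR that im by (auto simp: graph_iso_def gball_nat)
  have "\<phi> ` nbrs G z = nbrs H (\<phi> z)"
  proof
    show "\<phi> ` nbrs G z \<subseteq> nbrs H (\<phi> z)"
      using sub edge by (auto simp: nbrs_def)
    show "nbrs H (\<phi> z) \<subseteq> \<phi> ` nbrs G z"
    proof
      fix w assume w: "w \<in> nbrs H (\<phi> z)"
      then obtain v where "v \<in> reach G x R" "w = \<phi> v"
        using subH im by blast
      then show "w \<in> \<phi> ` nbrs G z"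
        using w edge by (auto simp: nbrs_def)
    qed
  qed
  moreover have "inj_on \<phi> (nbrs G z)"
    using inj sub by (rule inj_on_subset)
  ultimately show ?thesis
    by (simp add: bij_betw_def)
qed

lemma srw_op_eq: "srw_op G f x = (\<Sum>y\<in>nbrs G x. f y) / of_nat (degree G x)"
  unfolding srw_op_def sum_divide_distrib
  by (rule sum.cong) (auto simp: srw_def nbrs_def)

text \<open>For a walk started at \<open>z\<close>, the number \<open>(P ^^ k) (delta x) z\<close> is the probability to be at \<open>x\<close> at
  time \<open>k\<close>. Each step enlarges by one the part of the graph that matters, which is why the range of \<open>z\<close>
  shrinks with \<open>k\<close>.\<close>

lemma ball_iso_srw_power:
  assumes G: "is_graph G" "x \<in> verts G" and H: "is_graph H" "y \<in> verts H"
    and iso: "graph_iso \<phi> (gball G x (real R)) (gball H y (real R))" "\<phi> x = y"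
    and "k \<le> R" "z \<in> reach G x (R - k)"
  shows "(srw_op G ^^ k) (delta x) z = (srw_op H ^^ k) (delta y) (\<phi> z)"
  using \<open>k \<le> R\<close> \<open>z \<in> reach G x (R - k)\<close>
proof (induction k arbitrary: z)
  case 0
  have inj: "inj_on \<phi> (reach G x R)"
    using iso by (auto simp: graph_iso_def gball_nat bij_betw_def)
  have "x \<in> reach G x R"
    using reach_0[OF G(2)] reach_mono[of 0 R G x] by auto
  then have "\<phi> z = y \<longleftrightarrow> z = x"
    using inj 0 iso(2) by (auto dest: inj_onD)
  then show ?case by (simp add: delta_def)
next
  case (Suc k)
  have bij: "bij_betw \<phi> (nbrs G z) (nbrs H (\<phi> z))"
    using ball_iso_nbrs[OF G H iso _ Suc.prems(2)] Suc.prems(1) by simp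
  have "(srw_op G ^^ k) (delta x) w = (srw_op H ^^ k) (delta y) (\<phi> w)" if "w \<in> nbrs G z" for w
  proof (rule Suc.IH)
    show "w \<in> reach G x (R - k)"
      using reach_Suc[OF G(1) Suc.prems(2), of w] that Suc.prems(1)
      by (simp add: nbrs_def Suc_diff_Suc)
  qed (use Suc.prems in simp)
  then have "(\<Sum>w\<in>nbrs G z. (srw_op G ^^ k) (delta x) w)
      = (\<Sum>w\<in>nbrs G z. (srw_op H ^^ k) (delta y) (\<phi> w))"
    by (rule sum.cong[OF refl])
  also have "\<dots> = (\<Sum>w\<in>nbrs H (\<phi> z). (srw_op H ^^ k) (delta y) w)"
    by (rule sum.reindex_bij_betw[OF bij])
  finally show ?case
    using bij_betw_same_card[OF bij] by (simp add: degree_def srw_op_eq[of G _ z] srw_op_eq[of H _ "\<phi> z"])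
qed

lemma ball_iso_return:
  assumes "is_graph G" "x \<in> verts G" "is_graph H" "y \<in> verts H"
    and "rooted_isomorphic (gball G x (real N)) x (gball H y (real N)) y"
  shows "(srw_op G ^^ N) (delta x) x = (srw_op H ^^ N) (delta y) y"
  using assms ball_iso_srw_power[of G x H y _ N N x] reach_0[of x G]
  by (auto simp: rooted_isomorphic_def)

text \<open>The operator averages over neighbours, or gives \<open>0\<close> at a vertex whose \<open>degree\<close> is \<open>0\<close> (by
  convention also when it has infinitely many neighbours).\<close>

lemma cmod_srw_op_le:
  assumes "\<And>y. y \<in> nbrs G x \<Longrightarrow> cmod (f y) \<le> b" "0 \<le> b"
  shows "cmod (srw_op G f x) \<le> b"
proof (cases "degree G x = 0")
  case False
  have "cmod (\<Sum>y\<in>nbrs G x. f y) \<le> (\<Sum>y\<in>nbrs G x. b)"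
    using assms by (intro order_trans[OF norm_sum] sum_mono)
  also have "\<dots> = real (degree G x) * b"
    by (simp add: degree_def)
  finally show ?thesis
    using False by (simp add: srw_op_eq norm_divide field_simps)
qed (use assms in \<open>simp add: srw_op_eq\<close>)

lemma cmod_srw_power_le: "cmod ((srw_op G ^^ k) (delta x) y) \<le> 1"
  by (induction k arbitrary: y) (auto simp: delta_def intro!: cmod_srw_op_le)

definition mean_return :: "'b graph \<Rightarrow> nat \<Rightarrow> complex" where
  "mean_return Y N = (\<Sum>x\<in>verts Y. (srw_op Y ^^ N) (delta x) x) / of_nat (card (verts Y))"

text \<open>Good vertices have exactly the return probability of the limit graph, and each bad vertex
  contributes an error of at most 2.\<close>

lemma mean_return_bound:
  assumes X: "is_graph X" "r \<in> verts X"
    and Y: "is_graph Y" "finite (verts Y)" "verts Y \<noteq> {}"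
  shows "cmod (mean_return Y N - (srw_op X ^^ N) (delta r) r)
    \<le> 2 * (real (card (bad_verts (2 * N) Y X r)) / real (card (verts Y)))"
proof -
  let ?p = "(srw_op X ^^ N) (delta r) r"
  let ?q = "\<lambda>x. (srw_op Y ^^ N) (delta x) x"
  let ?B = "bad_verts (2 * N) Y X r"
  have pos: "card (verts Y) > 0"
    using Y by (simp add: card_gt_0_iff)
  have sub: "?B \<subseteq> verts Y"
    by (auto simp: bad_verts_def)
  have "(\<Sum>x\<in>verts Y. ?q x - ?p) = (\<Sum>x\<in>?B. ?q x - ?p)"
  proof (rule sum.mono_neutral_right[OF Y(2) sub], rule ballI)
    fix x assume "x \<in> verts Y - ?B"
    then have "rooted_isomorphic (gball Y x (real N)) x (gball X r (real N)) r" "x \<in> verts Y"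
      by (auto simp: bad_verts_def)
    then show "?q x - ?p = 0"
      using ball_iso_return[of Y x X r N] X Y by simp
  qed
  also have "cmod \<dots> \<le> (\<Sum>x\<in>?B. 2)"
  proof (intro order_trans[OF norm_sum] sum_mono)
    fix x
    show "cmod (?q x - ?p) \<le> 2"
      using norm_triangle_ineq4[of "?q x" ?p] cmod_srw_power_le[of N Y x x]
        cmod_srw_power_le[of N X r r] by linarith
  qed
  finally have "cmod (\<Sum>x\<in>verts Y. ?q x - ?p) \<le> 2 * real (card ?B)"
    by simp
  moreover have "mean_return Y N - ?p = (\<Sum>x\<in>verts Y. ?q x - ?p) / of_nat (card (verts Y))"
    using pos by (simp add: mean_return_def sum_subtractf field_simps)
  ultimately show ?thesis
    using pos by (simp add: norm_divide divide_right_mono)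
qed

lemma mean_return_tendsto:
  assumes "is_graph X" "r \<in> verts X" "foelner_approximation Xs X r"
    and "\<And>n. is_graph (Xs n)" "\<And>n. finite (verts (Xs n))" "\<And>n. verts (Xs n) \<noteq> {}"
  shows "(\<lambda>n. mean_return (Xs n) N) \<longlonglongrightarrow> (srw_op X ^^ N) (delta r) r"
proof (rule LIM_zero_cancel, rule Lim_null_comparison)
  show "\<forall>\<^sub>F n in sequentially. cmod (mean_return (Xs n) N - (srw_op X ^^ N) (delta r) r)
    \<le> 2 * (real (card (bad_verts (2 * N) (Xs n) X r)) / real (card (verts (Xs n))))"
    using assms by (intro always_eventually allI mean_return_bound) auto
  show "(\<lambda>n. 2 * (real (card (bad_verts (2 * N) (Xs n) X r)) / real (card (verts (Xs n)))))
    \<longlonglongrightarrow> 0"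
    using assms(3) by (intro tendsto_mult_right_zero) (simp add: foelner_approximation_def)
qed

section \<open>The walk on a finite graph is diagonalisable\<close>

lemma sum_fun_apply: "(\<Sum>i\<in>I. F i) x = (\<Sum>i\<in>I. F i x)" for F :: "'i \<Rightarrow> 'a \<Rightarrow> 'b::comm_monoid_add"
  by (induction I rule: infinite_finite_induct) auto

lemma srw_op_add: "srw_op G (f + g) = srw_op G f + srw_op G g"
  by (simp add: fun_eq_iff srw_op_eq sum.distrib add_divide_distrib)

lemma srw_op_fscale: "srw_op G (fscale c f) = fscale c (srw_op G f)"
  by (simp add: fun_eq_iff srw_op_eq fscale_def flip: sum_distrib_left)

lemma srw_op_0: "srw_op G 0 = 0"
  by (simp add: fun_eq_iff srw_op_eq)

lemma srw_op_sum: "srw_op G (\<Sum>i\<in>I. F i) = (\<Sum>i\<in>I. srw_op G (F i))"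
  using sum_comp_morphism[of "srw_op G" F I] by (simp add: srw_op_0 srw_op_add o_def)

text \<open>The vector \<open>p(P) v\<close>, for a polynomial \<open>p\<close> (Horner scheme).\<close>

definition poly_srw :: "'a graph \<Rightarrow> complex poly \<Rightarrow> ('a \<Rightarrow> complex) \<Rightarrow> ('a \<Rightarrow> complex)" where
  "poly_srw G p v = fold_coeffs (\<lambda>a f. fscale a v + srw_op G f) p 0"

lemma poly_srw_0 [simp]: "poly_srw G 0 v = 0"
  by (simp add: poly_srw_def)

lemma poly_srw_pCons [simp]:
  "poly_srw G (pCons a p) v = fscale a v + srw_op G (poly_srw G p v)"
proof (cases "p = 0")
  case True
  then show ?thesis by (cases "a = 0") (simp_all add: poly_srw_def srw_op_0)
next
  case False
  then show ?thesis by (simp add: poly_srw_def)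
qed

lemma poly_srw_add: "poly_srw G (p + q) v = poly_srw G p v + poly_srw G q v"
proof (rule poly_induct2[of _ p q])
  fix a b p q
  assume "poly_srw G (p + q) v = poly_srw G p v + poly_srw G q v"
  then show "poly_srw G (pCons a p + pCons b q) v
      = poly_srw G (pCons a p) v + poly_srw G (pCons b q) v"
    by (simp add: srw_op_add fun_vs.scale_left_distrib)
qed simp

lemma poly_srw_sum: "poly_srw G (\<Sum>i\<in>I. p i) v = (\<Sum>i\<in>I. poly_srw G (p i) v)"
  using sum_comp_morphism[of "\<lambda>p. poly_srw G p v" p I] by (simp add: poly_srw_add o_def)

lemma poly_srw_smult: "poly_srw G (smult c p) v = fscale c (poly_srw G p v)"
proof (rule pCons_induct[of _ p])
  fix a p
  assume "poly_srw G (smult c p) v = fscale c (poly_srw G p v)"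
  then show "poly_srw G (smult c (pCons a p)) v = fscale c (poly_srw G (pCons a p) v)"
    by (simp add: srw_op_fscale fun_vs.scale_right_distrib)
qed (simp only: smult_0_right poly_srw_0 fun_vs.scale_zero_right)

lemma poly_srw_monom: "poly_srw G (monom c i) v = fscale c ((srw_op G ^^ i) v)"
proof (rule nat_induct[of _ i])
  show "poly_srw G (monom c 0) v = fscale c ((srw_op G ^^ 0) v)"
    by (simp add: monom_0 srw_op_0)
next
  fix i
  assume "poly_srw G (monom c i) v = fscale c ((srw_op G ^^ i) v)"
  then show "poly_srw G (monom c (Suc i)) v = fscale c ((srw_op G ^^ Suc i) v)"
    by (simp add: monom_Suc srw_op_fscale)
qed

lemma poly_srw_linear_factor:
  "poly_srw G ([:- z, 1:] * q) v = srw_op G (poly_srw G q v) - fscale z (poly_srw G q v)"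
proof -
  have "[:- z, 1:] * q = pCons 0 q + smult (- z) q"
    by (simp add: mult_pCons_left)
  then show ?thesis
    by (simp only: poly_srw_add poly_srw_smult poly_srw_pCons fun_vs.scale_zero_left
        fun_vs.scale_minus_left add_0 diff_conv_add_uminus)
qed

text \<open>If \<open>p(P) v = 0\<close>, the linear factors of \<open>p\<close> can be applied to \<open>v\<close> one after the other; the
  last nonzero vector before \<open>0\<close> is reached is an eigenvector.\<close>

lemma poly_srw_eigenvector:
  assumes W: "\<And>f g. f \<in> W \<Longrightarrow> g \<in> W \<Longrightarrow> f + g \<in> W" "\<And>c f. f \<in> W \<Longrightarrow> fscale c f \<in> W"
      "\<And>f. f \<in> W \<Longrightarrow> srw_op G f \<in> W"
    and v: "v \<in> W" "v \<noteq> 0" and "p \<noteq> 0" "poly_srw G p v = 0"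
  shows "\<exists>u\<in>W. u \<noteq> 0 \<and> (\<exists>l. srw_op G u = fscale l u)"
  using \<open>p \<noteq> 0\<close> \<open>poly_srw G p v = 0\<close>
proof (induction "Polynomial.degree p" arbitrary: p rule: less_induct)
  case less
  have "0 \<in> W"
    using W(2)[OF v(1), of 0] by (simp add: fun_vs.scale_zero_left)
  then have inW: "poly_srw G q v \<in> W" for q
    by (induction q) (auto intro: W v)
  show ?case
  proof (cases "Polynomial.degree p = 0")
    case True
    then obtain c where "p = [:c:]"
      by (meson degree_eq_zeroE)
    with less.prems v show ?thesis
      by (simp add: srw_op_0)
  next
    case False
    then have "\<not> constant (poly p)"
      by (simp add: constant_degree)
    then obtain z where "poly p z = 0"
      using fundamental_theorem_of_algebra by blast
    then obtain q where q: "p = [:- z, 1:] * q"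
      by (auto simp: poly_eq_0_iff_dvd)
    then have q0: "q \<noteq> 0"
      using less.prems by auto
    then have deg: "Polynomial.degree q < Polynomial.degree p"
      unfolding q by (subst degree_mult_eq) auto
    show ?thesis
    proof (cases "poly_srw G q v = 0")
      case True
      then show ?thesis using less.hyps[OF deg q0] by blast
    next
      case nz: False
      have "srw_op G (poly_srw G q v) = fscale z (poly_srw G q v)"
        using less.prems(2) unfolding q poly_srw_linear_factor by simp
      then show ?thesis using inW nz by blast
    qed
  qed
qed

locale finite_walk =
  fixes G :: "'a graph"
  assumes graph: "is_graph G" and fin: "finite (verts G)" and no_iso: "no_isolated G"
begin

abbreviation "T \<equiv> srw_op G"

abbreviation "supported f \<equiv> (\<forall>x. x \<notin> verts G \<longrightarrow> f x = (0::complex))"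

lemma nbrs_eq: "nbrs G x = {y \<in> verts G. (x, y) \<in> edges G}"
  using graph by (auto simp: nbrs_def is_graph_def)

lemma edges_sym: "(x, y) \<in> edges G \<longleftrightarrow> (y, x) \<in> edges G"
  using graph by (auto simp: is_graph_def dest: symD)

lemma degree_pos: "x \<in> verts G \<Longrightarrow> degree G x > 0"
  using no_iso fin by (auto simp: no_isolated_def degree_def card_gt_0_iff nbrs_eq)

lemma supported_T: "supported (T f)"
proof (intro allI impI)
  fix x assume "x \<notin> verts G"
  then have "nbrs G x = {}"
    using graph by (auto simp: nbrs_def is_graph_def)
  then show "T f x = 0" by (simp add: srw_op_eq)
qed

text \<open>The inner product weighted by the degrees, the reversible measure of the walk, makes the
  transition operator self-adjoint.\<close>

definition dip :: "('a \<Rightarrow> complex) \<Rightarrow> ('a \<Rightarrow> complex) \<Rightarrow> complex" where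
  "dip f g = (\<Sum>x\<in>verts G. of_nat (degree G x) * cnj (f x) * g x)"

lemma dip_add_right: "dip f (g + h) = dip f g + dip f h"
  by (simp add: dip_def algebra_simps sum.distrib)

lemma dip_diff_right: "dip f (g - h) = dip f g - dip f h"
  by (simp add: dip_def algebra_simps sum_subtractf)

lemma dip_scale_right: "dip f (fscale c g) = c * dip f g"
  by (simp add: dip_def fscale_def sum_distrib_left mult_ac)

lemma dip_scale_left: "dip (fscale c f) g = cnj c * dip f g"
  by (simp add: dip_def fscale_def sum_distrib_left mult_ac)

lemma dip_zero_right [simp]: "dip f 0 = 0"
  by (simp add: dip_def)

lemma dip_sum_right: "dip f (\<Sum>i\<in>I. F i) = (\<Sum>i\<in>I. dip f (F i))"
  using sum_comp_morphism[of "dip f" F I] by (simp add: dip_add_right o_def)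

lemma dip_cnj: "cnj (dip f g) = dip g f"
  by (simp add: dip_def mult_ac)

lemma dip_T_right: "dip f (T g) = (\<Sum>x\<in>verts G. \<Sum>y\<in>nbrs G x. cnj (f x) * g y)"
  unfolding dip_def
proof (rule sum.cong[OF refl])
  fix x assume "x \<in> verts G"
  then show "of_nat (degree G x) * cnj (f x) * T g x = (\<Sum>y\<in>nbrs G x. cnj (f x) * g y)"
    using degree_pos[of x] by (simp add: srw_op_eq flip: sum_distrib_left)
qed

lemma T_selfadjoint: "dip (T f) g = dip f (T g)"
proof -
  have "dip (T f) g = cnj (dip g (T f))"
    by (simp add: dip_cnj)
  also have "\<dots> = (\<Sum>x\<in>verts G. \<Sum>y\<in>{y \<in> verts G. (x, y) \<in> edges G}. g x * cnj (f y))"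
    by (simp add: dip_T_right nbrs_eq)
  also have "\<dots> = (\<Sum>y\<in>verts G. \<Sum>x\<in>{x \<in> verts G. (x, y) \<in> edges G}. g x * cnj (f y))"
    by (rule sum.swap_restrict[OF fin fin])
  also have "\<dots> = dip f (T g)"
    unfolding dip_T_right nbrs_eq by (simp add: edges_sym mult_ac)
  finally show ?thesis .
qed

lemma dip_self: "dip f f = of_real (\<Sum>x\<in>verts G. real (degree G x) * (cmod (f x))\<^sup>2)"
  unfolding dip_def of_real_sum
  by (rule sum.cong) (auto simp: mult.assoc complex_norm_square[symmetric] mult.commute)

lemma dip_self_pos:
  assumes "supported f" "f \<noteq> 0"
  shows "Re (dip f f) > 0"
proof -
  obtain x where x: "f x \<noteq> 0" "x \<in> verts G"
    using assms by (auto simp: fun_eq_iff)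
  then show ?thesis
    using degree_pos[OF x(2)] fin unfolding dip_self
    by (auto intro!: sum_pos2[of _ x])
qed

lemma supported_in_span: "supported f \<Longrightarrow> f \<in> fun_vs.span (delta ` verts G)"
proof -
  assume "supported f"
  then have "f = (\<Sum>x\<in>verts G. fscale (f x) (delta x))"
    using fin by (auto simp: fun_eq_iff sum_fun_apply fscale_def delta_def if_distrib
        cong: if_cong)
  also have "\<dots> \<in> fun_vs.span (delta ` verts G)"
    by (intro fun_vs.span_sum fun_vs.span_scale fun_vs.span_base) auto
  finally show ?thesis .
qed

lemma independent_card_le:
  assumes "fun_vs.independent S" "\<And>f. f \<in> S \<Longrightarrow> supported f"
  shows "finite S \<and> card S \<le> card (verts G)"
proof -
  have "S \<subseteq> fun_vs.span (delta ` verts G)"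
    using assms(2) supported_in_span by blast
  then have "finite S \<and> card S \<le> card (delta ` verts G)"
    using fun_vs.independent_span_bound[OF _ assms(1)] fin by blast
  then show ?thesis
    using card_image_le[OF fin, of delta] by linarith
qed

text \<open>Among the iterates \<open>v, P v, P\<^sup>2 v, \<dots>\<close> more than \<open>card (verts G)\<close> cannot be
  independent; two equal iterates are a linear relation as well.\<close>

lemma annihilating_poly:
  assumes "supported v"
  shows "\<exists>p. p \<noteq> 0 \<and> poly_srw G p v = 0"
proof -
  let ?n = "card (verts G)" and ?t = "\<lambda>i. (T ^^ i) v"
  have supp: "supported (?t i)" for i
    using assms supported_T by (cases i) auto
  show ?thesis
  proof (cases "inj_on ?t {..?n}")
    case True
    then have "card (?t ` {..?n}) = Suc ?n"
      by (simp add: card_image)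
    then have "fun_vs.dependent (?t ` {..?n})"
      using independent_card_le[of "?t ` {..?n}"] supp by fastforce
    then obtain c i where c: "i \<le> ?n" "c (?t i) \<noteq> 0" "(\<Sum>f\<in>?t ` {..?n}. fscale (c f) f) = 0"
      unfolding fun_vs.dependent_finite[OF finite_imageI[OF finite_atMost]] by blast
    let ?p = "\<Sum>j\<le>?n. monom (c (?t j)) j"
    have "poly_srw G ?p v = (\<Sum>j\<le>?n. fscale (c (?t j)) (?t j))"
      by (simp add: poly_srw_sum poly_srw_monom)
    also have "\<dots> = 0"
      using c(3) by (simp add: sum.reindex[OF True])
    finally have "poly_srw G ?p v = 0" .
    moreover have "coeff ?p i = c (?t i)"
      using c(1) by (simp add: coeff_sum)
    then have "?p \<noteq> 0"
      using c(2) by (metis coeff_0)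
    ultimately show ?thesis by blast
  next
    case False
    then obtain i j where ij: "?t i = ?t j" "i \<noteq> j"
      by (auto simp: inj_on_def)
    let ?p = "monom 1 i + monom (- 1) j :: complex poly"
    have "poly_srw G ?p v = 0"
      using ij by (simp add: poly_srw_add poly_srw_monom)
    moreover have "coeff ?p i = 1"
      using ij by simp
    then have "?p \<noteq> 0"
      by (metis coeff_0 zero_neq_one)
    ultimately show ?thesis by blast
  qed
qed

definition orthonormal_eigenvectors :: "('a \<Rightarrow> complex) set \<Rightarrow> bool" where
  "orthonormal_eigenvectors S \<longleftrightarrow> finite S \<and>
     (\<forall>e\<in>S. supported e \<and> dip e e = 1 \<and> (\<exists>l. T e = fscale l e)) \<and>
     (\<forall>e\<in>S. \<forall>f\<in>S. e \<noteq> f \<longrightarrow> dip e f = 0)"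

lemma orthonormal_coefficient:
  assumes "orthonormal_eigenvectors S" "S' \<subseteq> S" "e \<in> S"
  shows "dip e (\<Sum>f\<in>S'. fscale (c f) f) = (if e \<in> S' then c e else 0)"
proof -
  have "finite S'"
    using assms finite_subset by (auto simp: orthonormal_eigenvectors_def)
  have "dip e (\<Sum>f\<in>S'. fscale (c f) f) = (\<Sum>f\<in>S'. c f * dip e f)"
    by (simp add: dip_sum_right dip_scale_right)
  also have "\<dots> = (\<Sum>f\<in>S'. if f = e then c e else 0)"
    using assms by (intro sum.cong refl) (auto simp: orthonormal_eigenvectors_def)
  finally show ?thesis
    using \<open>finite S'\<close> by simp
qed

lemma orthonormal_independent:
  assumes "orthonormal_eigenvectors S" "S' \<subseteq> S"
  shows "fun_vs.independent S'"
proof -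
  have fS': "finite S'"
    using assms finite_subset by (auto simp: orthonormal_eigenvectors_def)
  show ?thesis
    unfolding fun_vs.dependent_finite[OF fS']
  proof clarify
    fix u e assume "e \<in> S'" "u e \<noteq> 0" and z: "(\<Sum>v\<in>S'. fscale (u v) v) = 0"
    then show False
      using orthonormal_coefficient[OF assms, of e u] assms(2) by auto
  qed
qed

text \<open>A largest orthonormal set of eigenvectors is a basis: its orthogonal complement is invariant,
  so if nonzero it would contain one more eigenvector.\<close>

lemma ex_eigenbasis:
  obtains S where "orthonormal_eigenvectors S"
    "\<And>f. supported f \<Longrightarrow> f = (\<Sum>e\<in>S. fscale (dip e f) e)"
proof -
  let ?P = orthonormal_eigenvectors
  have "?P {}"
    by (simp add: orthonormal_eigenvectors_def)
  moreover have "card S < Suc (card (verts G))" if "?P S" for S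
    using independent_card_le[OF orthonormal_independent[OF that order_refl]] that
    by (auto simp: orthonormal_eigenvectors_def)
  ultimately obtain S where S: "?P S" and mx: "\<And>S'. ?P S' \<Longrightarrow> card S' \<le> card S"
    using ex_has_greatest_nat[of ?P "{}" card] by blast
  have fS: "finite S"
    using S by (simp add: orthonormal_eigenvectors_def)
  define W where "W = {f. supported f \<and> (\<forall>e\<in>S. dip e f = 0)}"
  have W0: "f = 0" if "f \<in> W" for f
  proof (rule ccontr)
    assume "f \<noteq> 0"
    have Winv: "T g \<in> W" if "g \<in> W" for g
    proof -
      have "dip e (T g) = 0" if e: "e \<in> S" for e
      proof -
        have "\<exists>l. T e = fscale l e"
          using S e by (simp add: orthonormal_eigenvectors_def)
        then obtain l where "T e = fscale l e"
          by (rule exE)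
        then show ?thesis
          using \<open>g \<in> W\<close> that by (simp add: T_selfadjoint[symmetric] dip_scale_left W_def)
      qed
      then show ?thesis
        using supported_T by (simp add: W_def)
    qed
    obtain p where "p \<noteq> 0" "poly_srw G p f = 0"
      using annihilating_poly[of f] \<open>f \<in> W\<close> by (auto simp: W_def)
    moreover have "fscale c g \<in> W" if "g \<in> W" for c g
      using that by (simp add: W_def dip_scale_right) (simp add: fscale_def)
    moreover have "g + h \<in> W" if "g \<in> W" "h \<in> W" for g h
      using that by (simp add: W_def dip_add_right)
    ultimately have "\<exists>u\<in>W. u \<noteq> 0 \<and> (\<exists>l. T u = fscale l u)"
      using \<open>f \<in> W\<close> \<open>f \<noteq> 0\<close> Winv by (intro poly_srw_eigenvector[of W G f p])
    then obtain u l where u: "u \<in> W" "u \<noteq> 0" "T u = fscale l u"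
      by blast
    have pos: "Re (dip u u) > 0"
      using u dip_self_pos by (auto simp: W_def)
    define s where "s = complex_of_real (1 / sqrt (Re (dip u u)))"
    define w where "w = fscale s u"
    have "dip u u = of_real (Re (dip u u))"
      by (simp add: dip_self)
    then have "dip w w = of_real ((1 / sqrt (Re (dip u u))) * ((1 / sqrt (Re (dip u u))) * Re (dip u u)))"
      unfolding w_def dip_scale_left dip_scale_right s_def
      by (metis complex_cnj_complex_of_real of_real_mult)
    also have "\<dots> = 1"
      using pos by (simp add: field_simps flip: power2_eq_square)
    finally have ww: "dip w w = 1" .
    have wW: "supported w" "\<And>e. e \<in> S \<Longrightarrow> dip e w = 0"
      using u(1) by (simp_all add: W_def w_def dip_scale_right) (simp add: fscale_def)
    have "T w = fscale l w"
      using u(3) by (simp add: w_def srw_op_fscale fun_vs.scale_left_commute)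
    moreover have "dip w e = 0" if "e \<in> S" for e
      using wW(2)[OF that] dip_cnj[of e w] by simp
    ultimately have "?P (insert w S)"
      using S ww wW by (auto simp: orthonormal_eigenvectors_def)
    moreover have "w \<notin> S"
      using wW(2)[of w] ww by auto
    ultimately show False
      using mx[of "insert w S"] fS by simp
  qed
  have "f = (\<Sum>e\<in>S. fscale (dip e f) e)" if "supported f" for f
  proof -
    let ?g = "\<Sum>e\<in>S. fscale (dip e f) e"
    have "dip e (f - ?g) = 0" if "e \<in> S" for e
      using orthonormal_coefficient[OF S order_refl that, of "\<lambda>e. dip e f"] that
      by (simp add: dip_diff_right)
    moreover have "supported ?g"
      using S by (auto simp: sum_fun_apply fscale_def orthonormal_eigenvectors_def
          intro!: sum.neutral)
    ultimately have "f - ?g \<in> W"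
      using that by (simp add: W_def)
    then have "f - ?g = 0"
      by (rule W0)
    then show ?thesis
      by simp
  qed
  with S show thesis
    by (rule that)
qed

text \<open>At a vertex where \<open>\<bar>f\<bar>\<close> is largest, averaging cannot increase \<open>\<bar>f\<bar>\<close>.\<close>

lemma eigenvalue_le_1:
  assumes "supported f" "f \<noteq> 0" "T f = fscale l f"
  shows "cmod l \<le> 1"
proof -
  obtain y where y: "f y \<noteq> 0" "y \<in> verts G"
    using assms by (auto simp: fun_eq_iff)
  let ?A = "(\<lambda>z. cmod (f z)) ` verts G"
  have "Max ?A \<in> ?A"
    using y fin by (intro Max_in) auto
  then obtain x where x1: "Max ?A = cmod (f x)" "x \<in> verts G"
    by (rule imageE)
  have x: "x \<in> verts G" "\<And>z. z \<in> verts G \<Longrightarrow> cmod (f z) \<le> cmod (f x)"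
    unfolding x1(1)[symmetric] using fin x1(2) by (auto intro: Max_ge)
  have "cmod (T f x) \<le> cmod (f x)"
    using x by (intro cmod_srw_op_le) (auto simp: nbrs_eq)
  then have "cmod l * cmod (f x) \<le> 1 * cmod (f x)"
    using assms(3) by (simp add: fscale_def norm_mult)
  moreover have "cmod (f x) > 0"
    using x(2)[OF y(2)] y(1) by (auto intro: less_le_trans[of _ "cmod (f y)"])
  ultimately show ?thesis
    by (simp only: mult_le_cancel_right_pos)
qed

text \<open>The trace of \<open>P ^^ N\<close>, computed in the basis of vertices and in a basis of eigenvectors; the
  eigenvectors for one eigenvalue are a basis of its eigenspace, by orthogonality of the others.\<close>

theorem spectral_decomposition:
  obtains S :: "('a \<Rightarrow> complex) set" and lam :: "('a \<Rightarrow> complex) \<Rightarrow> real"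
  where "finite S" "\<And>e. e \<in> S \<Longrightarrow> \<bar>lam e\<bar> \<le> 1"
    "\<And>N. (\<Sum>e\<in>S. complex_of_real (lam e) ^ N) = (\<Sum>x\<in>verts G. (T ^^ N) (delta x) x)"
    "\<And>g. (\<Sum>l\<in>srw_spec G. real (eigen_mult G l) * g (Re l)) = (\<Sum>e\<in>S. g (lam e))"
proof -
  obtain S where S: "orthonormal_eigenvectors S"
    and basis: "\<And>f. supported f \<Longrightarrow> f = (\<Sum>e\<in>S. fscale (dip e f) e)"
    by (rule ex_eigenbasis) blast
  have fS: "finite S" and supp: "\<And>e. e \<in> S \<Longrightarrow> supported e"
    and one: "\<And>e. e \<in> S \<Longrightarrow> dip e e = 1"
    and ex: "\<And>e. e \<in> S \<Longrightarrow> \<exists>l. T e = fscale l e"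
    using S by (auto simp: orthonormal_eigenvectors_def)
  have ne: "e \<noteq> 0" if "e \<in> S" for e
    using one[OF that] by auto
  have real_ev: "cnj l = l" if "T f = fscale l f" "supported f" "f \<noteq> 0" for l f
  proof -
    have "cnj l * dip f f = l * dip f f"
      using T_selfadjoint[of f f] that(1) by (simp add: dip_scale_left dip_scale_right)
    moreover have "dip f f \<noteq> 0"
      using dip_self_pos[OF that(2,3)] by auto
    ultimately show ?thesis by simp
  qed
  define mu where "mu e = (SOME l. T e = fscale l e)" for e
  define lam where "lam e = Re (mu e)" for e
  have mu: "T e = fscale (mu e) e" if "e \<in> S" for e
    unfolding mu_def using ex[OF that] by (rule someI_ex)
  have mu_lam: "mu e = of_real (lam e)" if "e \<in> S" for e
    using real_ev[OF mu[OF that] supp[OF that] ne[OF that]]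
    by (simp add: lam_def complex_eq_iff)
  have uniq: "l = l'" if "fscale l f = fscale l' f" "f \<noteq> 0" for l l' and f :: "'a \<Rightarrow> complex"
    using that by (simp add: fun_vs.scale_right_imp_eq)
  have le1: "\<bar>lam e\<bar> \<le> 1" if "e \<in> S" for e
    using eigenvalue_le_1[OF supp[OF that] ne[OF that] mu[OF that]] mu_lam[OF that] by simp
  have pow: "(T ^^ N) f = (\<Sum>e\<in>S. fscale (dip e f * mu e ^ N) e)" if "supported f" for N f
  proof (induction N)
    case 0
    then show ?case using basis[OF that] by simp
  next
    case (Suc N)
    have "(T ^^ Suc N) f = (\<Sum>e\<in>S. T (fscale (dip e f * mu e ^ N) e))"
      using Suc by (simp add: srw_op_sum)
    also have "\<dots> = (\<Sum>e\<in>S. fscale (dip e f * mu e ^ Suc N) e)"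
      by (rule sum.cong) (auto simp: srw_op_fscale mu mult_ac)
    finally show ?case .
  qed
  have trace: "(\<Sum>e\<in>S. complex_of_real (lam e) ^ N) = (\<Sum>x\<in>verts G. (T ^^ N) (delta x) x)" for N
  proof -
    have coeff: "dip e (delta x) = of_nat (degree G x) * cnj (e x)" if "x \<in> verts G" for e x
      using that fin by (simp add: dip_def delta_def if_distrib cong: if_cong)
    have "(\<Sum>x\<in>verts G. (T ^^ N) (delta x) x)
        = (\<Sum>x\<in>verts G. \<Sum>e\<in>S. mu e ^ N * (of_nat (degree G x) * cnj (e x) * e x))"
    proof (rule sum.cong[OF refl])
      fix x assume x: "x \<in> verts G"
      then have "supported (delta x)"
        by (auto simp: delta_def)
      from pow[OF this] show "(T ^^ N) (delta x) x
          = (\<Sum>e\<in>S. mu e ^ N * (of_nat (degree G x) * cnj (e x) * e x))"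
        by (simp add: sum_fun_apply fscale_def coeff[OF x] mult_ac)
    qed
    also have "\<dots> = (\<Sum>e\<in>S. mu e ^ N * dip e e)"
      unfolding dip_def sum_distrib_left by (rule sum.swap)
    also have "\<dots> = (\<Sum>e\<in>S. complex_of_real (lam e) ^ N)"
      by (rule sum.cong) (auto simp: one mu_lam)
    finally show ?thesis by simp
  qed
  have eigen_coeff: "dip e f = 0" if "e \<in> S" "f \<in> eigenspace G l" "mu e \<noteq> l" for e f l
  proof -
    have "l * dip e f = dip e (T f)"
      using that by (simp add: eigenspace_def dip_scale_right)
    also have "\<dots> = cnj (mu e) * dip e f"
      using that by (simp add: T_selfadjoint[symmetric] mu dip_scale_left)
    finally show ?thesis
      using that mu_lam[OF that(1)] by auto
  qed
  have eigen_sum: "f = (\<Sum>e\<in>{e \<in> S. mu e = l}. fscale (dip e f) e)" if "f \<in> eigenspace G l" for f l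
  proof -
    have "f = (\<Sum>e\<in>S. fscale (dip e f) e)"
      using that by (intro basis) (simp add: eigenspace_def)
    also have "\<dots> = (\<Sum>e\<in>{e \<in> S. mu e = l}. fscale (dip e f) e)"
      using fS eigen_coeff that by (intro sum.mono_neutral_right) auto
    finally show ?thesis .
  qed
  have mult: "eigen_mult G l = card {e \<in> S. mu e = l}" for l
    unfolding eigen_mult_def
  proof (rule fun_vs.dim_unique)
    show "{e \<in> S. mu e = l} \<subseteq> eigenspace G l"
      using supp mu by (auto simp: eigenspace_def)
    show "fun_vs.independent {e \<in> S. mu e = l}"
      using orthonormal_independent[OF S] by auto
    show "eigenspace G l \<subseteq> fun_vs.span {e \<in> S. mu e = l}"
    proof
      fix f assume "f \<in> eigenspace G l"
      then have "f = (\<Sum>e\<in>{e \<in> S. mu e = l}. fscale (dip e f) e)"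
        by (rule eigen_sum)
      also have "\<dots> \<in> fun_vs.span {e \<in> S. mu e = l}"
        by (intro fun_vs.span_sum fun_vs.span_scale fun_vs.span_base)
      finally show "f \<in> fun_vs.span {e \<in> S. mu e = l}" .
    qed
  qed simp
  have spec: "srw_spec G = mu ` S"
  proof
    show "mu ` S \<subseteq> srw_spec G"
    proof (rule image_subsetI)
      fix e assume "e \<in> S"
      then have "e \<in> eigenspace G (mu e)" "e \<noteq> 0"
        using supp mu ne by (auto simp: eigenspace_def)
      then show "mu e \<in> srw_spec G"
        unfolding srw_spec_def by blast
    qed
    show "srw_spec G \<subseteq> mu ` S"
    proof
      fix l assume "l \<in> srw_spec G"
      then obtain f where f: "f \<in> eigenspace G l" "f \<noteq> 0"
        by (auto simp: srw_spec_def)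
      have "{e \<in> S. mu e = l} \<noteq> {}"
      proof
        assume "{e \<in> S. mu e = l} = {}"
        then have "f = 0"
          using eigen_sum[OF f(1)] by (simp only: sum.empty)
        with f(2) show False ..
      qed
      then show "l \<in> mu ` S" by auto
    qed
  qed
  have weights: "(\<Sum>l\<in>srw_spec G. real (eigen_mult G l) * g (Re l)) = (\<Sum>e\<in>S. g (lam e))"
    for g :: "real \<Rightarrow> real"
    unfolding spec mult lam_def
    using sum_fun_comp[of S "mu ` S" mu "\<lambda>l. g (Re l)"] fS by simp
  show thesis
    using fS le1 trace weights by (rule that)
qed

end

section \<open>The method of moments on a bounded interval\<close>

lemma integrable_continuous_on_borel_set:
  fixes f :: "real \<Rightarrow> real"
  assumes M: "finite_measure M" and sets: "sets M = sets borel"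
    and "AE x in M. \<bar>x\<bar> \<le> a" "continuous_on UNIV f" "B \<in> sets borel"
  shows "integrable M (\<lambda>x. indicator B x * f x)"
proof -
  have "compact (f ` {-a..a})"
    using assms(4) by (intro compact_continuous_image) (auto intro: continuous_on_subset)
  then have "bounded (f ` {-a..a})"
    by (rule compact_imp_bounded)
  then obtain b where b: "\<And>x. x \<in> {-a..a} \<Longrightarrow> norm (f x) \<le> b"
    unfolding bounded_iff by blast
  have f: "f \<in> borel_measurable borel"
    using assms(4) by (rule borel_measurable_continuous_onI)
  show ?thesis
  proof (rule finite_measure.integrable_const_bound[OF M, of _ b])
    show "AE x in M. norm (indicator B x * f x) \<le> b"
      using assms(3)
    proof eventually_elim
      case (elim x)
      then have "norm (f x) \<le> b"
        by (intro b) auto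
      then show ?case
        by (auto simp: indicator_def)
    qed
    show "(\<lambda>x. indicator B x * f x) \<in> borel_measurable M"
      unfolding measurable_cong_sets[OF sets refl]
      using f assms(5) by (intro borel_measurable_times borel_measurable_indicator)
  qed
qed

lemma integrable_continuous_AE_bounded:
  fixes f :: "real \<Rightarrow> real"
  assumes "finite_measure M" "sets M = sets borel" "AE x in M. \<bar>x\<bar> \<le> a" "continuous_on UNIV f"
  shows "integrable M f"
  using integrable_continuous_on_borel_set[OF assms, of UNIV] by simp

lemma (in real_distribution) integral_uniform_close:
  fixes f g :: "real \<Rightarrow> real"
  assumes "AE x in M. \<bar>x\<bar> \<le> a" "continuous_on UNIV f" "continuous_on UNIV g"
    and "\<And>x. x \<in> {-a..a} \<Longrightarrow> \<bar>f x - g x\<bar> \<le> e"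
  shows "\<bar>integral\<^sup>L M f - integral\<^sup>L M g\<bar> \<le> e"
proof -
  note int = integrable_continuous_AE_bounded[OF finite_measure_axioms events_eq_borel assms(1)]
  have ifg: "integrable M (\<lambda>x. f x - g x)"
    using int assms by (intro Bochner_Integration.integrable_diff) auto
  have "integral\<^sup>L M f - integral\<^sup>L M g = (\<integral>x. f x - g x \<partial>M)"
    using int assms by simp
  also have "\<bar>\<dots>\<bar> \<le> (\<integral>x. \<bar>f x - g x\<bar> \<partial>M)"
    using integral_norm_bound[of M "\<lambda>x. f x - g x"] by simp
  also have "\<dots> \<le> (\<integral>x. e \<partial>M)"
  proof (rule integral_mono_AE)
    show "AE x in M. \<bar>f x - g x\<bar> \<le> e"
      using assms(1) by eventually_elim (auto intro!: assms(4))
  qed (use ifg in auto)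
  also have "\<dots> = e"
    using prob_space by simp
  finally show ?thesis .
qed

text \<open>By the Weierstrass theorem, a continuous function is on \<open>{-a..a}\<close> within \<open>e\<close> of a
  polynomial, whose integrals converge because the moments do.\<close>

theorem moments_tendsto_imp_weak_conv_m:
  fixes Ms :: "nat \<Rightarrow> real measure" and M :: "real measure"
  assumes Ms: "\<And>n. real_distribution (Ms n)" and M: "real_distribution M"
    and suppn: "\<And>n. AE x in Ms n. \<bar>x\<bar> \<le> a" and supp: "AE x in M. \<bar>x\<bar> \<le> a"
    and moments: "\<And>k. (\<lambda>n. \<integral>x. x ^ k \<partial>Ms n) \<longlonglongrightarrow> (\<integral>x. x ^ k \<partial>M)"
  shows "weak_conv_m Ms M"
proof (rule integral_bdd_continuous_conv_imp_weak_conv[OF Ms M])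
  fix f :: "real \<Rightarrow> real"
  assume "\<And>x. isCont f x"
  then have f: "continuous_on UNIV f"
    by (simp add: continuous_at_imp_continuous_on)
  show "(\<lambda>n. integral\<^sup>L (Ms n) f) \<longlonglongrightarrow> integral\<^sup>L M f"
  proof (rule LIMSEQ_I)
    fix e :: real assume "e > 0"
    have "compact {-a..a}" "continuous_on {-a..a} f" "e / 3 > 0"
      using f \<open>e > 0\<close> by (auto intro: continuous_on_subset)
    then obtain g where "real_polynomial_function g"
      and g: "\<And>x. x \<in> {-a..a} \<Longrightarrow> \<bar>f x - g x\<bar> < e / 3"
      by (rule Stone_Weierstrass_real_polynomial_function) blast
    then obtain c m where c: "g = (\<lambda>x. \<Sum>i\<le>m. c i * x ^ i)"
      unfolding real_polynomial_function_iff_sum by blast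
    have gc: "continuous_on UNIV g"
      unfolding c by (intro continuous_intros)
    have gint: "integral\<^sup>L N g = (\<Sum>i\<le>m. c i * (\<integral>x. x ^ i \<partial>N))"
      if "real_distribution N" "AE x in N. \<bar>x\<bar> \<le> a" for N :: "real measure"
    proof -
      have "integrable N (\<lambda>x. x ^ i)" for i
        using that real_distribution.events_eq_borel real_distribution.axioms(1)
        by (intro integrable_continuous_AE_bounded[of N a] continuous_intros prob_space.finite_measure)
          auto
      then show ?thesis unfolding c by simp
    qed
    have "(\<lambda>n. integral\<^sup>L (Ms n) g) \<longlonglongrightarrow> integral\<^sup>L M g"
      unfolding gint[OF M supp] gint[OF Ms suppn] by (intro tendsto_intros moments)
    then obtain n0 where n0: "\<And>n. n \<ge> n0 \<Longrightarrow> \<bar>integral\<^sup>L (Ms n) g - integral\<^sup>L M g\<bar> < e / 3"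
      using LIMSEQ_D[of "\<lambda>n. integral\<^sup>L (Ms n) g" _ "e / 3"] \<open>e > 0\<close> by (auto simp: real_norm_def)
    have close: "\<bar>integral\<^sup>L N f - integral\<^sup>L N g\<bar> \<le> e / 3"
      if "real_distribution N" "AE x in N. \<bar>x\<bar> \<le> a" for N :: "real measure"
      using that f gc g by (intro real_distribution.integral_uniform_close[of N a]) (auto intro: less_imp_le)
    have "\<bar>integral\<^sup>L (Ms n) f - integral\<^sup>L M f\<bar> < e" if "n \<ge> n0" for n
      using n0[OF that] close[OF M supp] close[OF Ms suppn, of n] by linarith
    then show "\<exists>n0. \<forall>n\<ge>n0. norm (integral\<^sup>L (Ms n) f - integral\<^sup>L M f) < e"
      by auto
  qed
qed

section \<open>Square-summable functions\<close>

lemma ell2_summable: "f \<in> ell2 V \<Longrightarrow> (\<lambda>x. (cmod (f x))\<^sup>2) summable_on V"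
  by (simp add: ell2_def)

lemma ell2_abs_summable:
  assumes "f \<in> ell2 V" "g \<in> ell2 V"
  shows "(\<lambda>x. cmod (cnj (f x) * g x)) summable_on V"
proof (rule summable_on_comparison_test)
  show "(\<lambda>x. (cmod (f x))\<^sup>2 + (cmod (g x))\<^sup>2) summable_on V"
    using assms by (intro summable_on_add ell2_summable)
  fix x
  have "2 * (cmod (f x) * cmod (g x)) \<le> (cmod (f x))\<^sup>2 + (cmod (g x))\<^sup>2"
    using sum_squares_bound[of "cmod (f x)" "cmod (g x)"] by simp
  then show "cmod (cnj (f x) * g x) \<le> (cmod (f x))\<^sup>2 + (cmod (g x))\<^sup>2"
    using mult_nonneg_nonneg[OF norm_ge_zero norm_ge_zero, of "f x" "g x"]
    unfolding norm_mult complex_mod_cnj by linarith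
qed simp

lemma ell2_inner_summable:
  assumes "f \<in> ell2 V" "g \<in> ell2 V"
  shows "(\<lambda>x. cnj (f x) * g x) summable_on V"
  using abs_summable_summable[OF ell2_abs_summable[OF assms]] .

lemma ell2_zero: "0 \<in> ell2 V"
  by (simp add: ell2_def)

lemma ell2_add:
  assumes "f \<in> ell2 V" "g \<in> ell2 V"
  shows "f + g \<in> ell2 V"
proof -
  have "(\<lambda>x. (cmod (f x + g x))\<^sup>2) summable_on V"
  proof (rule summable_on_comparison_test)
    show "(\<lambda>x. 2 * ((cmod (f x))\<^sup>2 + (cmod (g x))\<^sup>2)) summable_on V"
      using assms by (intro summable_on_cmult_right summable_on_add ell2_summable)
    fix x
    have "(cmod (f x + g x))\<^sup>2 \<le> (cmod (f x) + cmod (g x))\<^sup>2"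
      by (intro power_mono norm_triangle_ineq) simp
    also have "\<dots> \<le> 2 * ((cmod (f x))\<^sup>2 + (cmod (g x))\<^sup>2)"
      using sum_squares_bound[of "cmod (f x)" "cmod (g x)"] by (simp add: power2_sum)
    finally show "(cmod (f x + g x))\<^sup>2 \<le> 2 * ((cmod (f x))\<^sup>2 + (cmod (g x))\<^sup>2)" .
  qed simp
  then show ?thesis
    using assms by (simp add: ell2_def)
qed

lemma ell2_scale:
  assumes "f \<in> ell2 V"
  shows "fscale c f \<in> ell2 V"
  using summable_on_cmult_right[OF ell2_summable[OF assms], of "(cmod c)\<^sup>2"] assms
  by (simp add: ell2_def fscale_def norm_mult power_mult_distrib)

lemma ell2_diff: "f \<in> ell2 V \<Longrightarrow> g \<in> ell2 V \<Longrightarrow> f - g \<in> ell2 V"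
  using ell2_add[of f V "fscale (- 1) g"] ell2_scale[of g V "- 1"] by simp

lemma ell2_sum: "(\<And>i. i \<in> I \<Longrightarrow> F i \<in> ell2 V) \<Longrightarrow> (\<Sum>i\<in>I. F i) \<in> ell2 V"
  by (induction I rule: infinite_finite_induct) (auto simp: ell2_zero intro: ell2_add)

lemma ell2_inner_add_right:
  assumes "f \<in> ell2 V" "g \<in> ell2 V" "h \<in> ell2 V"
  shows "ell2_inner V f (g + h) = ell2_inner V f g + ell2_inner V f h"
  using infsum_add[OF ell2_inner_summable[OF assms(1,2)] ell2_inner_summable[OF assms(1,3)]]
  by (simp add: ell2_inner_def distrib_left)

lemma ell2_inner_scale_right: "ell2_inner V f (fscale c g) = c * ell2_inner V f g"
  using infsum_cmult_right'[of c "\<lambda>x. cnj (f x) * g x" V]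
  by (simp add: ell2_inner_def fscale_def mult_ac)

lemma ell2_inner_cnj: "cnj (ell2_inner V f g) = ell2_inner V g f"
  unfolding ell2_inner_def infsum_cnj[symmetric] by (simp add: mult.commute)

lemma ell2_inner_add_left:
  assumes "f \<in> ell2 V" "g \<in> ell2 V" "h \<in> ell2 V"
  shows "ell2_inner V (f + g) h = ell2_inner V f h + ell2_inner V g h"
  using arg_cong[OF ell2_inner_add_right[OF assms(3,1,2)], of cnj] by (simp add: ell2_inner_cnj)

lemma ell2_inner_scale_left: "ell2_inner V (fscale c f) g = cnj c * ell2_inner V f g"
  using arg_cong[OF ell2_inner_scale_right[of V g c f], of cnj] by (simp add: ell2_inner_cnj)

lemma ell2_inner_zero_right [simp]: "ell2_inner V f 0 = 0"
  by (simp add: ell2_inner_def)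

lemma ell2_inner_diff_right:
  assumes "f \<in> ell2 V" "g \<in> ell2 V" "h \<in> ell2 V"
  shows "ell2_inner V f (g - h) = ell2_inner V f g - ell2_inner V f h"
  using ell2_inner_add_right[OF assms(1) ell2_diff[OF assms(2,3)] assms(3)] by simp

lemma ell2_inner_sum_right:
  assumes "f \<in> ell2 V" "\<And>i. i \<in> I \<Longrightarrow> F i \<in> ell2 V"
  shows "ell2_inner V f (\<Sum>i\<in>I. F i) = (\<Sum>i\<in>I. ell2_inner V f (F i))"
  using assms(2)
proof (induction I rule: infinite_finite_induct)
  case (insert i I)
  then have "ell2_inner V f (F i + (\<Sum>i\<in>I. F i))
      = ell2_inner V f (F i) + ell2_inner V f (\<Sum>i\<in>I. F i)"
    using assms(1) by (intro ell2_inner_add_right ell2_sum) auto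
  with insert have "ell2_inner V f (sum F (insert i I)) = (\<Sum>i\<in>insert i I. ell2_inner V f (F i))"
    by simp
  then show ?case .
qed (simp_all only: sum.infinite sum.empty ell2_inner_zero_right not_False_eq_True)

lemma ell2_inner_self:
  assumes "f \<in> ell2 V"
  shows "ell2_inner V f f = of_real ((ell2_norm V f)\<^sup>2)"
proof -
  have "ell2_inner V f f = (\<Sum>\<^sub>\<infinity>x\<in>V. of_real ((cmod (f x))\<^sup>2))"
    unfolding ell2_inner_def
    by (rule infsum_cong) (simp only: complex_norm_square mult.commute)
  also have "\<dots> = of_real (\<Sum>\<^sub>\<infinity>x\<in>V. (cmod (f x))\<^sup>2)"
    using has_sum_of_real[OF has_sum_infsum[OF ell2_summable[OF assms]]] by (rule infsumI)
  finally show ?thesis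
    by (simp add: ell2_norm_def infsum_nonneg)
qed

lemma ell2_norm_nonneg [simp]: "ell2_norm V f \<ge> 0"
  by (simp add: ell2_norm_def infsum_nonneg)

lemma ell2_norm_eq_0:
  assumes "f \<in> ell2 V" "ell2_norm V f = 0"
  shows "f = 0"
proof
  fix x
  have "(\<Sum>\<^sub>\<infinity>x\<in>V. (cmod (f x))\<^sup>2) \<le> 0"
    using assms(2) by (simp add: ell2_norm_def)
  then have "x \<in> V \<Longrightarrow> (cmod (f x))\<^sup>2 = 0"
    by (rule nonneg_infsum_le_0D[OF _ ell2_summable[OF assms(1)]]) auto
  then show "f x = 0 x"
    using assms(1) by (auto simp: ell2_def)
qed

lemma ell2_Cauchy_Schwarz:
  assumes f: "f \<in> ell2 V" and g: "g \<in> ell2 V"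
  shows "cmod (ell2_inner V f g) \<le> ell2_norm V f * ell2_norm V g"
proof -
  have "cmod (ell2_inner V f g) \<le> (\<Sum>\<^sub>\<infinity>x\<in>V. cmod (cnj (f x) * g x))"
    unfolding ell2_inner_def by (rule norm_infsum_bound[OF ell2_abs_summable[OF f g]])
  also have "\<dots> \<le> ell2_norm V f * ell2_norm V g"
  proof (rule infsum_le_finite_sums[OF ell2_abs_summable[OF f g]])
    fix F assume F: "finite F" "F \<subseteq> V"
    have part: "(\<Sum>x\<in>F. (cmod (h x))\<^sup>2) \<le> (ell2_norm V h)\<^sup>2" if "h \<in> ell2 V" for h
      using finite_sum_le_infsum[OF ell2_summable[OF that] F]
      by (simp add: ell2_norm_def infsum_nonneg)
    have "(\<Sum>x\<in>F. cmod (f x) * cmod (g x))\<^sup>2 \<le> (\<Sum>x\<in>F. (cmod (f x))\<^sup>2) * (\<Sum>x\<in>F. (cmod (g x))\<^sup>2)"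
      by (rule Cauchy_Schwarz_ineq_sum)
    also have "\<dots> \<le> (ell2_norm V f)\<^sup>2 * (ell2_norm V g)\<^sup>2"
      using part f g by (intro mult_mono) (auto intro: sum_nonneg)
    finally have "(\<Sum>x\<in>F. cmod (f x) * cmod (g x))\<^sup>2 \<le> (ell2_norm V f * ell2_norm V g)\<^sup>2"
      by (simp add: power_mult_distrib)
    then show "(\<Sum>x\<in>F. cmod (cnj (f x) * g x)) \<le> ell2_norm V f * ell2_norm V g"
      by (simp add: norm_mult) (rule power2_le_imp_le, simp_all)
  qed
  finally show ?thesis .
qed

lemma delta_in_ell2:
  assumes "r \<in> V"
  shows "delta r \<in> ell2 V"
proof -
  have "(\<lambda>x. (cmod (delta r x))\<^sup>2) summable_on V \<longleftrightarrow> (\<lambda>x. (cmod (delta r x))\<^sup>2) summable_on {r}"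
    using assms by (intro summable_on_cong_neutral) (auto simp: delta_def)
  then show ?thesis
    using assms by (auto simp: ell2_def delta_def)
qed

lemma ell2_inner_delta:
  assumes "r \<in> V"
  shows "ell2_inner V (delta r) g = g r"
proof -
  have "ell2_inner V (delta r) g = (\<Sum>\<^sub>\<infinity>x\<in>{r}. cnj (delta r x) * g x)"
    unfolding ell2_inner_def using assms by (intro infsum_cong_neutral) (auto simp: delta_def)
  then show ?thesis
    by (simp add: delta_def)
qed

section \<open>Sums of measures with a density\<close>

text \<open>The hypothesis says that \<open>A\<close> is the sum of the measure with density \<open>w\<close> over \<open>M\<close> and of
  \<open>c\<close> times \<open>N\<close>. The formula for integrals extends from indicators to all measurable functions by
  monotone convergence.\<close>

lemma nn_integral_density_plus:
  assumes [measurable_cong]: "sets M = sets A" "sets N = sets A"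
    and w [measurable]: "w \<in> borel_measurable A"
    and eq: "\<And>B. B \<in> sets A \<Longrightarrow> emeasure A B = (\<integral>\<^sup>+x. w x * indicator B x \<partial>M) + c * emeasure N B"
    and u: "u \<in> borel_measurable A"
  shows "(\<integral>\<^sup>+x. u x \<partial>A) = (\<integral>\<^sup>+x. w x * u x \<partial>M) + c * (\<integral>\<^sup>+x. u x \<partial>N)"
  using u
proof (induction rule: borel_measurable_induct)
  case (cong f g)
  have "space M = space A" "space N = space A"
    using assms(1,2) by (auto dest: sets_eq_imp_space_eq)
  then have "(\<integral>\<^sup>+x. f x \<partial>A) = (\<integral>\<^sup>+x. g x \<partial>A)" "(\<integral>\<^sup>+x. w x * f x \<partial>M) = (\<integral>\<^sup>+x. w x * g x \<partial>M)"
    "(\<integral>\<^sup>+x. f x \<partial>N) = (\<integral>\<^sup>+x. g x \<partial>N)"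
    using cong(3) by (auto intro!: nn_integral_cong)
  with cong(4) show ?case by simp
next
  case (set B)
  then have "B \<in> sets N"
    using assms(2) by simp
  with set show ?case by (simp add: eq)
next
  case (mult u d)
  have "(\<integral>\<^sup>+x. w x * (d * u x) \<partial>M) = d * (\<integral>\<^sup>+x. w x * u x \<partial>M)"
    using mult(2) by (subst nn_integral_cmult[symmetric]) (auto simp: mult_ac)
  with mult show ?case
    by (simp add: nn_integral_cmult distrib_left mult_ac)
next
  case (add u v)
  have "(\<integral>\<^sup>+x. w x * (v x + u x) \<partial>M) = (\<integral>\<^sup>+x. w x * v x \<partial>M) + (\<integral>\<^sup>+x. w x * u x \<partial>M)"
    using add by (subst nn_integral_add[symmetric]) (auto simp: distrib_left)
  with add show ?case
    by (simp add: nn_integral_add distrib_left ac_simps)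
next
  case (seq U)
  note [measurable] = seq(1)
  have incM: "incseq (\<lambda>i x. w x * U i x)"
    using seq(3) by (auto simp: incseq_def le_fun_def intro!: mult_left_mono)
  have inc: "incseq (\<lambda>i. integral\<^sup>N L (F i))" if "incseq F" for F :: "nat \<Rightarrow> 'a \<Rightarrow> ennreal" and L
    using that by (auto simp: incseq_def le_fun_def intro!: nn_integral_mono)
  have "(\<integral>\<^sup>+x. (SUP i. U i x) \<partial>A) = (SUP i. \<integral>\<^sup>+x. U i x \<partial>A)"
    using seq by (intro nn_integral_monotone_convergence_SUP) auto
  also have "\<dots> = (SUP i. (\<integral>\<^sup>+x. w x * U i x \<partial>M) + c * (\<integral>\<^sup>+x. U i x \<partial>N))"
    using seq by simp
  also have "\<dots> = (SUP i. \<integral>\<^sup>+x. w x * U i x \<partial>M) + (SUP i. c * (\<integral>\<^sup>+x. U i x \<partial>N))"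
    using inc[OF incM] inc[OF seq(3)]
    by (intro ennreal_SUP_add) (auto simp: incseq_def intro!: mult_left_mono)
  also have "(SUP i. \<integral>\<^sup>+x. w x * U i x \<partial>M) = (\<integral>\<^sup>+x. (SUP i. w x * U i x) \<partial>M)"
    using incM by (intro nn_integral_monotone_convergence_SUP[symmetric]) auto
  also have "\<dots> = (\<integral>\<^sup>+x. w x * (SUP i. U i x) \<partial>M)"
    by (simp add: SUP_mult_left_ennreal)
  also have "(SUP i. c * (\<integral>\<^sup>+x. U i x \<partial>N)) = c * (SUP i. \<integral>\<^sup>+x. U i x \<partial>N)"
    by (simp add: SUP_mult_left_ennreal)
  also have "(SUP i. \<integral>\<^sup>+x. U i x \<partial>N) = (\<integral>\<^sup>+x. (SUP i. U i x) \<partial>N)"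
    using seq by (intro nn_integral_monotone_convergence_SUP[symmetric]) auto
  finally show ?case
    by (simp add: SUP_apply image_comp)
qed

text \<open>The version for Bochner integrals on a bounded interval. Outside \<open>{-a..a}\<close>, a null set for the three
  measures, \<open>w\<close> and \<open>u\<close> may be negative; this allows affine functions.\<close>

lemma integral_density_plus:
  fixes w u :: "real \<Rightarrow> real"
  assumes fin: "finite_measure A" "finite_measure M" "finite_measure N"
    and sets: "sets A = sets borel" "sets M = sets borel" "sets N = sets borel"
    and supp: "AE x in A. \<bar>x\<bar> \<le> a" "AE x in M. \<bar>x\<bar> \<le> a" "AE x in N. \<bar>x\<bar> \<le> a"
    and w: "continuous_on UNIV w" "\<And>x. \<bar>x\<bar> \<le> a \<Longrightarrow> 0 \<le> w x"
    and u: "continuous_on UNIV u" "\<And>x. \<bar>x\<bar> \<le> a \<Longrightarrow> 0 \<le> u x" and "0 \<le> c"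
    and eq: "\<And>B. B \<in> sets borel \<Longrightarrow>
      measure A B = (\<integral>x. indicator B x * w x \<partial>M) + c * measure N B"
    and B: "B \<in> sets borel"
  shows "(\<integral>x. indicator B x * u x \<partial>A)
    = (\<integral>x. indicator B x * (w x * u x) \<partial>M) + c * (\<integral>x. indicator B x * u x \<partial>N)"
proof -
  have wm: "w \<in> borel_measurable borel" and um: "u \<in> borel_measurable borel"
    using w u by (auto intro: borel_measurable_continuous_onI)
  have nn: "(\<integral>\<^sup>+x. ennreal (indicator B x * v x) \<partial>L) = ennreal (\<integral>x. indicator B x * v x \<partial>L)"
    and nonneg: "(\<integral>x. indicator B x * v x \<partial>L) \<ge> 0"
    if "finite_measure L" "sets L = sets borel" "AE x in L. \<bar>x\<bar> \<le> a"
      "continuous_on UNIV v" "\<And>x. \<bar>x\<bar> \<le> a \<Longrightarrow> 0 \<le> v x" "B \<in> sets borel" for L v B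
  proof -
    have ae: "AE x in L. 0 \<le> indicator B x * v x"
      using that(3) by eventually_elim (auto intro!: mult_nonneg_nonneg that(5))
    then show "(\<integral>\<^sup>+x. ennreal (indicator B x * v x) \<partial>L) = ennreal (\<integral>x. indicator B x * v x \<partial>L)"
      using integrable_continuous_on_borel_set that by (intro nn_integral_eq_integral) auto
    show "(\<integral>x. indicator B x * v x \<partial>L) \<ge> 0"
      using ae by (rule integral_nonneg_AE)
  qed
  have em: "emeasure A C = (\<integral>\<^sup>+x. ennreal (w x) * indicator C x \<partial>M) + ennreal c * emeasure N C"
    if "C \<in> sets A" for C
  proof -
    have C: "C \<in> sets borel" using that sets by simp
    have "emeasure A C = ennreal ((\<integral>x. indicator C x * w x \<partial>M) + c * measure N C)"
      using fin(1) eq[OF C] by (simp add: finite_measure.emeasure_eq_measure)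
    also have "\<dots> = ennreal (\<integral>x. indicator C x * w x \<partial>M) + ennreal c * emeasure N C"
      using fin(3) nonneg[OF fin(2) sets(2) supp(2) w C] \<open>0 \<le> c\<close>
      by (simp add: finite_measure.emeasure_eq_measure ennreal_plus ennreal_mult)
    also have "ennreal (\<integral>x. indicator C x * w x \<partial>M) = (\<integral>\<^sup>+x. ennreal (indicator C x * w x) \<partial>M)"
      using nn[OF fin(2) sets(2) supp(2) w C] by simp
    also have "\<dots> = (\<integral>\<^sup>+x. ennreal (w x) * indicator C x \<partial>M)"
      by (rule nn_integral_cong) (auto simp: indicator_def)
    finally show ?thesis .
  qed
  have "(\<integral>\<^sup>+x. ennreal (indicator B x * u x) \<partial>A)
      = (\<integral>\<^sup>+x. ennreal (w x) * ennreal (indicator B x * u x) \<partial>M)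
        + ennreal c * (\<integral>\<^sup>+x. ennreal (indicator B x * u x) \<partial>N)"
  proof (rule nn_integral_density_plus[OF _ _ _ em])
    have "(\<lambda>x. ennreal (indicator B x * u x)) \<in> borel_measurable borel"
      using um B by (intro measurable_compose[OF _ measurable_ennreal] borel_measurable_times
          borel_measurable_indicator)
    then show "(\<lambda>x. ennreal (indicator B x * u x)) \<in> borel_measurable A"
      unfolding measurable_cong_sets[OF sets(1) refl] .
    show "(\<lambda>x. ennreal (w x)) \<in> borel_measurable A"
      unfolding measurable_cong_sets[OF sets(1) refl]
      using wm by (intro measurable_compose[OF _ measurable_ennreal])
  qed (use sets in simp_all)
  also have "(\<integral>\<^sup>+x. ennreal (w x) * ennreal (indicator B x * u x) \<partial>M)
      = (\<integral>\<^sup>+x. ennreal (indicator B x * (w x * u x)) \<partial>M)"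
  proof (rule nn_integral_cong_AE)
    show "AE x in M. ennreal (w x) * ennreal (indicator B x * u x)
        = ennreal (indicator B x * (w x * u x))"
      using supp(2) by eventually_elim (auto simp: indicator_def ennreal_mult w u)
  qed
  also have "\<dots> = ennreal (\<integral>x. indicator B x * (w x * u x) \<partial>M)"
    using w u fin sets supp B by (intro nn continuous_intros) auto
  also have "(\<integral>\<^sup>+x. ennreal (indicator B x * u x) \<partial>N) = ennreal (\<integral>x. indicator B x * u x \<partial>N)"
    using u fin sets supp B by (intro nn) auto
  also have "(\<integral>\<^sup>+x. ennreal (indicator B x * u x) \<partial>A) = ennreal (\<integral>x. indicator B x * u x \<partial>A)"
    using u fin sets supp B by (intro nn) auto
  also have "ennreal (\<integral>x. indicator B x * (w x * u x) \<partial>M)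
        + ennreal c * ennreal (\<integral>x. indicator B x * u x \<partial>N)
      = ennreal ((\<integral>x. indicator B x * (w x * u x) \<partial>M) + c * (\<integral>x. indicator B x * u x \<partial>N))"
  proof -
    have "0 \<le> (\<integral>x. indicator B x * (w x * u x) \<partial>M)"
      using w u fin sets supp B by (intro nonneg continuous_intros) auto
    moreover have "0 \<le> (\<integral>x. indicator B x * u x \<partial>N)"
      using u fin sets supp B by (intro nonneg) auto
    ultimately show ?thesis
      using \<open>0 \<le> c\<close> by (simp add: ennreal_plus ennreal_mult)
  qed
  finally show ?thesis
  proof (rule ennreal_inj[THEN iffD1, rotated 2])
    show "0 \<le> (\<integral>x. indicator B x * u x \<partial>A)"
      using u fin sets supp B by (intro nonneg) auto
    have "0 \<le> (\<integral>x. indicator B x * (w x * u x) \<partial>M)"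
      using w u fin sets supp B by (intro nonneg continuous_intros) auto
    moreover have "0 \<le> (\<integral>x. indicator B x * u x \<partial>N)"
      using u fin sets supp B by (intro nonneg) auto
    ultimately show "0 \<le> (\<integral>x. indicator B x * (w x * u x) \<partial>M) + c * (\<integral>x. indicator B x * u x \<partial>N)"
      using \<open>0 \<le> c\<close> by simp
  qed
qed

section \<open>Moments of the spectral measures of a resolution of the identity\<close>

locale spectral_resolution =
  fixes V :: "'a set" and T :: "('a \<Rightarrow> complex) \<Rightarrow> 'a \<Rightarrow> complex"
    and E :: "real set \<Rightarrow> ('a \<Rightarrow> complex) \<Rightarrow> 'a \<Rightarrow> complex"
  assumes resolution: "resolution_of_identity V T E"
    and T_in: "f \<in> ell2 V \<Longrightarrow> T f \<in> ell2 V"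
    and T_add: "T (f + g) = T f + T g"
    and T_scale: "T (fscale c f) = fscale c (T f)"
begin

abbreviation "H \<equiv> ell2 V"
abbreviation "ip \<equiv> ell2_inner V"
abbreviation "mu \<equiv> spectral_measure V E"

lemma E_projection: "B \<in> sets borel \<Longrightarrow> orth_projection V (E B)"
  using resolution by (simp add: resolution_of_identity_def)

lemma
  assumes "B \<in> sets borel" "f \<in> H"
  shows E_in: "E B f \<in> H"
    and E_add: "g \<in> H \<Longrightarrow> E B (f + g) = E B f + E B g"
    and E_scale: "E B (fscale c f) = fscale c (E B f)"
    and E_idem: "E B (E B f) = E B f"
    and E_adj: "g \<in> H \<Longrightarrow> ip (E B f) g = ip f (E B g)"
  using E_projection[OF assms(1)] assms(2) by (simp_all add: orth_projection_def)

lemma E_Int: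
  "A \<in> sets borel \<Longrightarrow> B \<in> sets borel \<Longrightarrow> f \<in> H \<Longrightarrow> E (A \<inter> B) f = E A (E B f)"
  using resolution by (simp add: resolution_of_identity_def)

lemma E_empty: "f \<in> H \<Longrightarrow> E {} f = 0" and E_UNIV: "f \<in> H \<Longrightarrow> E UNIV f = f"
  using resolution by (simp_all add: resolution_of_identity_def)

lemma E_sums:
  "range A \<subseteq> sets borel \<Longrightarrow> disjoint_family A \<Longrightarrow> f \<in> H \<Longrightarrow>
    (\<lambda>n. ell2_norm V (E (\<Union>i. A i) f - (\<Sum>i<n. E (A i) f))) \<longlonglongrightarrow> 0"
  using resolution by (simp add: resolution_of_identity_def)

lemma quadratic_form: "f \<in> H \<Longrightarrow> ip f (T f) = complex_of_real (\<integral>l. l \<partial>mu f)"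
  using resolution by (simp add: resolution_of_identity_def)

text \<open>The partial sums of countable additivity for \<open>B\<close>, \<open>- B\<close>, \<open>{}\<close>, \<open>{}\<close>, and so on become constant, so
  their limit is attained.\<close>

lemma E_decompose:
  assumes B: "B \<in> sets borel" and f: "f \<in> H"
  shows "E B f + E (- B) f = f"
proof -
  let ?A = "binaryset B (- B)"
  have B': "- B \<in> sets borel"
    using B by (simp add: borel_comp)
  define S where "S n = (\<Sum>i<n. E (?A i) f)" for n
  have "(\<lambda>n. ell2_norm V (E (\<Union>i. ?A i) f - S n)) \<longlonglongrightarrow> 0"
    unfolding S_def using B B' f
    by (intro E_sums) (auto simp: range_binaryset_eq disjoint_family_on_def binaryset_def)
  then have "(\<lambda>n. ell2_norm V (f - S n)) \<longlonglongrightarrow> 0"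
    unfolding UN_binaryset_eq using f by (simp only: Compl_partition E_UNIV)
  then have lim: "(\<lambda>n. ell2_norm V (f - S (n + 2))) \<longlonglongrightarrow> 0"
    by (rule LIMSEQ_ignore_initial_segment)
  have S_0: "S 0 = 0" and S_Suc: "S (Suc n) = S n + E (?A n) f" for n
    unfolding S_def by (simp_all only: sum.lessThan_Suc lessThan_0 sum.empty)
  have "S (n + 2) = E B f + E (- B) f" for n
  proof (rule nat_induct[of _ n])
    show "S (0 + 2) = E B f + E (- B) f"
      by (simp only: numeral_2_eq_2 add_0_left S_Suc S_0) (simp add: binaryset_def)
  next
    fix n assume "S (n + 2) = E B f + E (- B) f"
    moreover have "E (?A (n + 2)) f = 0"
      using f by (simp add: binaryset_def E_empty)
    ultimately show "S (Suc n + 2) = E B f + E (- B) f"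
      using S_Suc[of "n + 2"] by simp
  qed
  with lim have "ell2_norm V (f - (E B f + E (- B) f)) = 0"
    by (simp add: LIMSEQ_const_iff)
  then have "f - (E B f + E (- B) f) = 0"
    using f B B' by (intro ell2_norm_eq_0) (auto intro!: ell2_diff ell2_add E_in)
  then show ?thesis
    by (simp add: diff_eq_eq)
qed

section \<open>The spectral measures are measures\<close>

definition weight :: "('a \<Rightarrow> complex) \<Rightarrow> real set \<Rightarrow> real" where
  "weight f B = Re (ip f (E B f))"

lemma inner_E_self:
  assumes "B \<in> sets borel" "f \<in> H"
  shows "ip f (E B f) = of_real (weight f B)"
proof -
  have "ip f (E B f) = ip (E B f) (E B f)"
    using assms by (simp add: E_adj E_in E_idem)
  also have "\<dots> = of_real ((ell2_norm V (E B f))\<^sup>2)"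
    using assms by (intro ell2_inner_self E_in)
  finally show ?thesis
    by (simp add: weight_def)
qed

lemma weight_nonneg:
  assumes "B \<in> sets borel" "f \<in> H"
  shows "weight f B \<ge> 0"
proof -
  have "ip f (E B f) = ip (E B f) (E B f)"
    using assms by (simp add: E_adj E_in E_idem)
  then show ?thesis
    using ell2_inner_self[OF E_in[OF assms]] by (simp add: weight_def)
qed

text \<open>Strong countable additivity of \<open>E\<close> gives the weak one by Cauchy-Schwarz.\<close>

lemma weight_sums:
  assumes A: "range A \<subseteq> sets borel" "disjoint_family A" and f: "f \<in> H"
  shows "(\<lambda>i. weight f (A i)) sums weight f (\<Union>i. A i)"
  unfolding sums_def
proof (rule LIM_zero_cancel, rule Lim_null_comparison)
  let ?D = "\<lambda>n. E (\<Union>i. A i) f - (\<Sum>i<n. E (A i) f)"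
  have in_H: "E (A i) f \<in> H" "E (\<Union>i. A i) f \<in> H" for i
    using A f by (auto intro!: E_in)
  then have D: "?D n \<in> H" for n
    by (intro ell2_diff ell2_sum)
  show "\<forall>\<^sub>F n in sequentially. norm ((\<Sum>i<n. weight f (A i)) - weight f (\<Union>i. A i))
      \<le> ell2_norm V f * ell2_norm V (?D n)"
  proof (intro always_eventually allI)
    fix n
    have "weight f (\<Union>i. A i) - (\<Sum>i<n. weight f (A i)) = Re (ip f (?D n))"
      using f in_H
      by (simp add: weight_def ell2_inner_diff_right ell2_sum ell2_inner_sum_right)
    also have "\<bar>\<dots>\<bar> \<le> cmod (ip f (?D n))"
      by (rule abs_Re_le_cmod)
    also have "\<dots> \<le> ell2_norm V f * ell2_norm V (?D n)"
      using f D by (rule ell2_Cauchy_Schwarz)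
    finally show "norm ((\<Sum>i<n. weight f (A i)) - weight f (\<Union>i. A i))
        \<le> ell2_norm V f * ell2_norm V (?D n)"
      by (simp add: abs_minus_commute)
  qed
  show "(\<lambda>n. ell2_norm V f * ell2_norm V (?D n)) \<longlonglongrightarrow> 0"
    using E_sums[OF A f] by (rule tendsto_mult_right_zero)
qed

lemma sets_mu [simp]: "sets (mu f) = sets borel" and space_mu [simp]: "space (mu f) = UNIV"
  using sets.sigma_sets_eq[of "borel :: real measure"]
  by (simp_all add: spectral_measure_def)

lemma measurable_mu [simp]: "measurable (mu f) N = measurable borel N"
  by (rule measurable_cong_sets) simp_all

lemma emeasure_mu:
  assumes f: "f \<in> H" and B: "B \<in> sets borel"
  shows "emeasure (mu f) B = ennreal (weight f B)"
proof -
  have "emeasure (mu f) B = ennreal (Re (ip f (E B f)))"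
    unfolding spectral_measure_def
  proof (rule emeasure_measure_of_sigma[of UNIV "sets borel" "\<lambda>B. ennreal (Re (ip f (E B f)))"])
    show "sigma_algebra UNIV (sets (borel :: real measure))"
      using sets.sigma_algebra_axioms[of "borel :: real measure"] by simp
    show "positive (sets borel) (\<lambda>B. ennreal (Re (ip f (E B f))))"
      using f by (simp add: positive_def E_empty)
    show "countably_additive (sets borel) (\<lambda>B. ennreal (Re (ip f (E B f))))"
      unfolding countably_additive_def weight_def[symmetric]
    proof (intro allI impI suminf_ennreal_eq)
      fix A :: "nat \<Rightarrow> real set" and i
      assume A: "range A \<subseteq> sets borel" "disjoint_family A"
      then show "weight f (A i) \<ge> 0"
        using f by (intro weight_nonneg) auto
      show "(\<lambda>i. weight f (A i)) sums weight f (\<Union>i. A i)"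
        using A f by (rule weight_sums)
    qed
  qed (use B in simp)
  then show ?thesis by (simp add: weight_def)
qed

lemma measure_mu: "f \<in> H \<Longrightarrow> B \<in> sets borel \<Longrightarrow> measure (mu f) B = weight f B"
  by (simp add: measure_def emeasure_mu weight_nonneg)

lemma finite_measure_mu: "f \<in> H \<Longrightarrow> finite_measure (mu f)"
  by (rule finite_measureI) (simp add: emeasure_mu)

text \<open>The bound \<open>a \<ge> 1\<close> makes it possible to divide by \<open>a\<close>.\<close>

lemma bounded_support:
  obtains a where "a \<ge> 1" "\<And>f. f \<in> H \<Longrightarrow> AE x in mu f. \<bar>x\<bar> \<le> a"
proof -
  have "\<exists>b. \<forall>f\<in>H. E {-b..b} f = f"
    using resolution by (simp add: resolution_of_identity_def)
  then obtain b where b: "\<And>f. f \<in> H \<Longrightarrow> E {-b..b} f = f"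
    by blast
  let ?a = "max b 1"
  have "AE x in mu f. \<bar>x\<bar> \<le> ?a" if f: "f \<in> H" for f
  proof (rule AE_I)
    have B: "- {-?a..?a} \<in> sets borel"
      by simp
    have "E (- {-?a..?a}) f = E (- {-?a..?a} \<inter> {-b..b}) f"
      using f b[OF f] B by (simp add: E_Int)
    also have "- {-?a..?a} \<inter> {-b..b} = {}"
      by auto
    also have "E {} f = 0"
      using f by (rule E_empty)
    finally show "emeasure (mu f) (- {-?a..?a}) = 0"
      using f B by (simp add: emeasure_mu weight_def)
    show "- {-?a..?a} \<in> sets (mu f)"
      by simp
    show "{x \<in> space (mu f). \<not> \<bar>x\<bar> \<le> ?a} \<subseteq> - {-?a..?a}"
      by auto
  qed
  then show thesis
    by (intro that[of ?a]) auto
qed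

lemma integrable_mu:
  fixes h :: "real \<Rightarrow> real"
  assumes "f \<in> H" "continuous_on UNIV h" "B \<in> sets borel"
  shows "integrable (mu f) (\<lambda>x. indicator B x * h x)"
proof -
  obtain a where "\<And>f. f \<in> H \<Longrightarrow> AE x in mu f. \<bar>x\<bar> \<le> a"
    using bounded_support by blast
  then show ?thesis
    using assms by (intro integrable_continuous_on_borel_set[of _ a] finite_measure_mu) auto
qed

section \<open>The operator commutes with its resolution\<close>

text \<open>Polarisation: a form whose quadratic values are real is Hermitian.\<close>

lemma T_symmetric:
  assumes f: "f \<in> H" and g: "g \<in> H"
  shows "ip (T f) g = ip f (T g)"
proof -
  define D where "D u v = ip u (T v) - ip (T u) v" for u v
  have D0: "D u u = 0" if "u \<in> H" for u
    using ell2_inner_cnj[of V u "T u"] quadratic_form[OF that] by (simp add: D_def)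
  have D_add: "D (u + v) (u + v) = D u u + D u v + D v u + D v v" if "u \<in> H" "v \<in> H" for u v
    using that by (simp add: D_def T_add ell2_inner_add_left ell2_inner_add_right T_in ell2_add)
  have D_scale: "D u (fscale c v) = c * D u v" "D (fscale c u) v = cnj c * D u v" for c u v
    by (simp_all add: D_def T_scale ell2_inner_scale_left ell2_inner_scale_right algebra_simps)
  have "D f g + D g f = 0"
    using D_add[OF f g] f g by (simp add: D0 ell2_add)
  moreover have "\<i> * D f g - \<i> * D g f = 0"
    using D_add[OF f ell2_scale[OF g, of \<i>]] f g by (simp add: D0 ell2_add ell2_scale D_scale)
  then have "D f g = D g f"
    by simp
  ultimately have "D f g = 0"
    by simp
  then show ?thesis by (simp add: D_def)
qed

lemma weight_E:
  assumes "f \<in> H" "A \<in> sets borel" "B \<in> sets borel"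
  shows "weight (E B f) A = weight f (A \<inter> B)"
proof -
  have "ip (E B f) (E A (E B f)) = ip f (E B (E A (E B f)))"
    using assms by (intro E_adj E_in) auto
  also have "E B (E A (E B f)) = E (B \<inter> (A \<inter> B)) f"
    using assms by (simp add: E_Int sets.Int)
  also have "B \<inter> (A \<inter> B) = A \<inter> B"
    by auto
  finally show ?thesis by (simp add: weight_def)
qed

lemma quadratic_form_E:
  assumes f: "f \<in> H" and B: "B \<in> sets borel"
  shows "ip (E B f) (T (E B f)) = of_real (\<integral>x. indicator B x * x \<partial>mu f)"
proof -
  have "mu (E B f) = density (mu f) (\<lambda>x. ennreal (indicator B x))"
  proof (rule measure_eqI)
    fix A assume "A \<in> sets (mu (E B f))"
    then have A: "A \<in> sets borel" by simp
    have "emeasure (density (mu f) (\<lambda>x. ennreal (indicator B x))) A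
        = (\<integral>\<^sup>+x. ennreal (indicator B x) * indicator A x \<partial>mu f)"
      using A B by (intro emeasure_density) auto
    also have "\<dots> = (\<integral>\<^sup>+x. indicator (A \<inter> B) x \<partial>mu f)"
      by (rule nn_integral_cong) (auto simp: indicator_def)
    also have "\<dots> = emeasure (mu f) (A \<inter> B)"
      using A B by (intro nn_integral_indicator) auto
    finally show "emeasure (mu (E B f)) A = emeasure (density (mu f) (\<lambda>x. ennreal (indicator B x))) A"
      using A B f by (simp add: emeasure_mu E_in weight_E sets.Int)
  qed simp
  then have "(\<integral>x. x \<partial>mu (E B f)) = (\<integral>x. indicator B x * x \<partial>mu f)"
    using B by (simp add: integral_density)
  then show ?thesis
    using quadratic_form[OF E_in[OF B f]] by simp
qed

text \<open>The quadratic form is an integral, and an integral splits over \<open>B\<close> and \<open>- B\<close>; so the mixed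
  terms of the form vanish.\<close>

lemma E_cross:
  assumes B: "B \<in> sets borel" and f: "f \<in> H" and g: "g \<in> H"
  shows "ip (E B f) (T (E (- B) g)) = 0"
proof -
  have B': "- B \<in> sets borel"
    using B by (simp add: borel_comp)
  \<comment> \<open>The two mixed terms are conjugate, so only the real part is seen; the imaginary part comes
    from replacing \<open>g\<close> by \<open>\<i> g\<close>.\<close>
  have Re0: "Re (ip (E B f) (T (E (- B) h))) = 0" if h: "h \<in> H" for h
  proof -
    let ?u = "E B f" and ?v = "E (- B) h"
    let ?w = "?u + ?v"
    have u: "?u \<in> H" and v: "?v \<in> H"
      using B B' f h by (auto intro: E_in)
    have "E B ?v = 0" "E (- B) ?u = 0"
      using B B' f h by (simp_all add: E_Int[symmetric] E_empty)
    then have Ew: "E B ?w = ?u" "E (- B) ?w = ?v"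
      using u v B B' f h by (simp_all add: E_add E_idem)
    have w: "?w \<in> H"
      using u v by (rule ell2_add)
    have int: "integrable (mu ?w) (\<lambda>x. indicator C x * x)" if "C \<in> sets borel" for C
      using w that by (intro integrable_mu) auto
    have "(\<integral>x. x \<partial>mu ?w) = (\<integral>x. indicator B x * x + indicator (- B) x * x \<partial>mu ?w)"
      by (rule Bochner_Integration.integral_cong) (auto simp: indicator_def)
    also have "\<dots> = (\<integral>x. indicator B x * x \<partial>mu ?w) + (\<integral>x. indicator (- B) x * x \<partial>mu ?w)"
      using int[OF B] int[OF B'] by (rule Bochner_Integration.integral_add)
    finally have "ip ?w (T ?w) = ip ?u (T ?u) + ip ?v (T ?v)"
      using quadratic_form[OF w] quadratic_form_E[OF w B] quadratic_form_E[OF w B'] by (simp add: Ew)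
    then have "ip ?u (T ?v) + ip ?v (T ?u) = 0"
      using u v
      by (simp add: T_add ell2_inner_add_left ell2_inner_add_right T_in ell2_add add.commute)
    moreover have "ip ?v (T ?u) = cnj (ip ?u (T ?v))"
      using T_symmetric[OF v u] ell2_inner_cnj[of V ?u "T ?v"] by simp
    ultimately have "complex_of_real (2 * Re (ip ?u (T ?v))) = 0"
      by (metis complex_add_cnj)
    then show ?thesis
      by (simp only: of_real_eq_0_iff)
  qed
  have "Re (ip (E B f) (T (E (- B) (fscale \<i> g)))) = 0"
    using g by (intro Re0 ell2_scale)
  then have "Im (ip (E B f) (T (E (- B) g))) = 0"
    using g B' by (simp add: E_scale T_scale ell2_inner_scale_right)
  with Re0[OF g] show ?thesis
    by (simp add: complex_eq_iff)
qed

text \<open>Seen from the range of \<open>E B\<close>, only the part \<open>E B g\<close> of \<open>g\<close> contributes to \<open>T g\<close>; together with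
  symmetry this lets \<open>E B\<close> pass from one side of \<open>T\<close> to the other.\<close>

lemma E_T_reduce:
  assumes B: "B \<in> sets borel" and f: "f \<in> H" and g: "g \<in> H"
  shows "ip (E B f) (T g) = ip (E B f) (T (E B g))"
proof -
  have B': "- B \<in> sets borel"
    using B by (simp add: borel_comp)
  have "ip (E B f) (T (E B g + E (- B) g)) = ip (E B f) (T (E B g)) + ip (E B f) (T (E (- B) g))"
    using assms B' by (simp only: T_add) (intro ell2_inner_add_right E_in T_in)
  then show ?thesis
    using assms by (simp add: E_decompose E_cross)
qed

lemma inner_E_T:
  assumes B: "B \<in> sets borel" and f: "f \<in> H"
  shows "ip f (E B (T f)) = of_real (\<integral>x. indicator B x * x \<partial>mu f)"
  using assms E_adj[OF B f T_in[OF f]] E_T_reduce[OF B f f] quadratic_form_E[OF f B] by simp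

lemma inner_T_E:
  assumes B: "B \<in> sets borel" and f: "f \<in> H"
  shows "ip (T f) (E B f) = of_real (\<integral>x. indicator B x * x \<partial>mu f)"
proof -
  have "ip (T f) (E B f) = cnj (ip f (E B (T f)))"
    using assms E_adj[OF B f T_in[OF f]] ell2_inner_cnj[of V "E B f" "T f"] by simp
  then show ?thesis
    using inner_E_T[OF assms] by simp
qed

text \<open>The projection passes the inner \<open>T\<close> by \<open>E_T_reduce\<close>; it can then be dropped on the left, because
  \<open>E_cross\<close> for \<open>- B\<close> removes the missing part.\<close>

lemma inner_E_TT:
  assumes B: "B \<in> sets borel" and f: "f \<in> H"
  shows "ip f (E B (T (T f))) = of_real (weight (T f) B)"
proof -
  have B': "- B \<in> sets borel"
    using B by (simp add: borel_comp)
  note Tf = T_in[OF f]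
  have "ip f (E B (T (T f))) = ip (E B f) (T (T f))"
    using assms by (simp add: E_adj T_in)
  also have "\<dots> = ip (E B f) (T (E B (T f)))"
    by (rule E_T_reduce[OF B f Tf])
  also have "\<dots> = ip f (T (E B (T f)))"
  proof -
    have "ip (E (- B) f) (T (E (- (- B)) (T f))) = 0"
      by (rule E_cross[OF B' f Tf])
    then have "ip (E B f + E (- B) f) (T (E B (T f))) = ip (E B f) (T (E B (T f)))"
      using assms B' by (subst ell2_inner_add_left) (auto intro!: E_in T_in)
    then show ?thesis
      using assms by (simp add: E_decompose)
  qed
  also have "\<dots> = ip (T f) (E B (T f))"
    using T_symmetric[OF f E_in[OF B Tf]] by simp
  finally show ?thesis
    using inner_E_self[OF B Tf] by simp
qed

section \<open>Applying the operator multiplies the spectral measure by \<open>l\<^sup>2\<close>\<close>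

text \<open>For \<open>g = f + t T f\<close> the measure of \<open>g\<close> is \<open>(1 + 2 t l) mu f + t\<^sup>2 mu (T f)\<close>, a sum of two
  positive measures once \<open>t\<close> is small compared with the support. Comparing the values of
  \<open>\<langle>g, E(B) T g\<rangle>\<close> computed from this formula and by expanding \<open>g\<close>, the terms of order
  \<open>t\<close> give the claim.\<close>

lemma weight_T:
  assumes B: "B \<in> sets borel" and f: "f \<in> H"
  shows "weight (T f) B = (\<integral>x. indicator B x * x\<^sup>2 \<partial>mu f)"
proof -
  obtain a where a: "a \<ge> 1" "\<And>f. f \<in> H \<Longrightarrow> AE x in mu f. \<bar>x\<bar> \<le> a"
    using bounded_support by blast
  \<comment> \<open>The largest \<open>t\<close> for which \<open>1 + 2 t x\<close> is nonnegative on \<open>{-a..a}\<close>.\<close>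
  define t where "t = 1 / (2 * a)"
  define g where "g = f + fscale (of_real t) (T f)"
  have t: "t > 0" "2 * t * a = 1"
    using a(1) by (simp_all add: t_def)
  have Tf: "T f \<in> H" and TTf: "T (T f) \<in> H" and g: "g \<in> H"
    using f by (auto simp: g_def intro!: T_in ell2_add ell2_scale)
  let ?q = "\<lambda>f B. \<integral>x. indicator B x * x \<partial>mu f"
  have int: "integrable (mu h) (\<lambda>x. indicator C x * p x)"
    if "h \<in> H" "continuous_on UNIV p" "C \<in> sets borel" for h C and p :: "real \<Rightarrow> real"
    using that by (rule integrable_mu)
  have weight_g: "weight g C = (\<integral>x. indicator C x * (1 + 2 * t * x) \<partial>mu f) + t\<^sup>2 * weight (T f) C"
    if C: "C \<in> sets borel" for C
  proof -
    have "ip g (E C g) = ip f (E C f) + of_real t * ip f (E C (T f))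
        + (of_real t * ip (T f) (E C f) + of_real (t\<^sup>2) * ip (T f) (E C (T f)))"
      using f Tf C unfolding g_def
      by (simp add: E_add E_scale ell2_inner_add_left ell2_inner_add_right ell2_inner_scale_left
          ell2_inner_scale_right ell2_scale ell2_add E_in power2_eq_square algebra_simps)
    also have "\<dots> = of_real (weight f C + 2 * t * ?q f C + t\<^sup>2 * weight (T f) C)"
      using f Tf C by (simp add: inner_E_self inner_E_T inner_T_E)
    finally have "weight g C = weight f C + 2 * t * ?q f C + t\<^sup>2 * weight (T f) C"
      by (simp add: weight_def)
    also have "weight f C = (\<integral>x. indicator C x * 1 \<partial>mu f)"
      using C f by (simp add: measure_mu)
    also have "(\<integral>x. indicator C x * 1 \<partial>mu f) + 2 * t * ?q f C
        = (\<integral>x. indicator C x * 1 + 2 * t * (indicator C x * x) \<partial>mu f)"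
      using int[OF f, of "\<lambda>_. 1" C] int[OF f, of "\<lambda>x. x" C] C by (simp add: continuous_on_id)
    also have "\<dots> = (\<integral>x. indicator C x * (1 + 2 * t * x) \<partial>mu f)"
      by (rule Bochner_Integration.integral_cong) (auto simp: algebra_simps)
    finally show ?thesis .
  qed
  \<comment> \<open>Integrating \<open>x + a\<close> instead of \<open>x\<close> keeps the integrand nonnegative.\<close>
  have "(\<integral>x. indicator B x * (x + a) \<partial>mu g)
      = (\<integral>x. indicator B x * ((1 + 2 * t * x) * (x + a)) \<partial>mu f)
        + t\<^sup>2 * (\<integral>x. indicator B x * (x + a) \<partial>mu (T f))"
  proof (rule integral_density_plus[where a = a])
    fix x :: real assume x: "\<bar>x\<bar> \<le> a"
    show "0 \<le> x + a" using x by simp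
    have "2 * t * (- a) \<le> 2 * t * x"
      using x t by (intro mult_left_mono) auto
    then show "0 \<le> 1 + 2 * t * x"
      using t(2) by simp
  next
    fix C :: "real set" assume "C \<in> sets borel"
    then show "measure (mu g) C = (\<integral>x. indicator C x * (1 + 2 * t * x) \<partial>mu f)
        + t\<^sup>2 * measure (mu (T f)) C"
      using weight_g Tf g by (simp add: measure_mu)
  qed (use f Tf g a B finite_measure_mu in \<open>auto intro!: continuous_intros\<close>)
  moreover have "(\<integral>x. indicator B x * (x + a) \<partial>mu h) = ?q h B + a * weight h B" if "h \<in> H" for h
  proof -
    have "(\<integral>x. indicator B x * (x + a) \<partial>mu h) = (\<integral>x. indicator B x * x + a * (indicator B x * 1) \<partial>mu h)"
      by (rule Bochner_Integration.integral_cong) (auto simp: algebra_simps)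
    also have "\<dots> = ?q h B + a * weight h B"
      using int[OF that, of "\<lambda>x. x" B] int[OF that, of "\<lambda>_. 1" B] B that
      by (simp add: measure_mu continuous_on_id)
    finally show ?thesis .
  qed
  moreover have "(\<integral>x. indicator B x * ((1 + 2 * t * x) * (x + a)) \<partial>mu f)
      = ?q f B + 2 * t * (\<integral>x. indicator B x * x\<^sup>2 \<partial>mu f)
        + a * (\<integral>x. indicator B x * (1 + 2 * t * x) \<partial>mu f)"
  proof -
    have "(\<integral>x. indicator B x * ((1 + 2 * t * x) * (x + a)) \<partial>mu f)
        = (\<integral>x. indicator B x * x + 2 * t * (indicator B x * x\<^sup>2)
            + a * (indicator B x * (1 + 2 * t * x)) \<partial>mu f)"
      by (rule Bochner_Integration.integral_cong) (auto simp: algebra_simps power2_eq_square)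
    also have "\<dots> = ?q f B + 2 * t * (\<integral>x. indicator B x * x\<^sup>2 \<partial>mu f)
        + a * (\<integral>x. indicator B x * (1 + 2 * t * x) \<partial>mu f)"
      using int[OF f, of "\<lambda>x. x" B] int[OF f, of "\<lambda>x. x\<^sup>2" B] int[OF f, of "\<lambda>x. 1 + 2 * t * x" B] B
      by (simp add: continuous_intros)
    finally show ?thesis .
  qed
  ultimately have q_g: "?q g B = ?q f B + 2 * t * (\<integral>x. indicator B x * x\<^sup>2 \<partial>mu f) + t\<^sup>2 * ?q (T f) B"
    using g Tf weight_g[OF B] by (simp add: algebra_simps)
  have "ip g (E B (T g)) = ip f (E B (T f)) + of_real t * ip f (E B (T (T f)))
      + (of_real t * ip (T f) (E B (T f)) + of_real (t\<^sup>2) * ip (T f) (E B (T (T f))))"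
    using f Tf TTf B unfolding g_def
    by (simp add: T_add T_scale E_add E_scale ell2_inner_add_left ell2_inner_add_right
        ell2_inner_scale_left ell2_inner_scale_right ell2_scale ell2_add E_in power2_eq_square
        algebra_simps)
  also have "\<dots> = of_real (?q f B + 2 * t * weight (T f) B + t\<^sup>2 * ?q (T f) B)"
    using f Tf B by (simp add: inner_E_T inner_E_TT inner_E_self)
  finally have "?q g B = ?q f B + 2 * t * weight (T f) B + t\<^sup>2 * ?q (T f) B"
    unfolding inner_E_T[OF B g] of_real_eq_iff .
  with q_g t(1) show ?thesis
    by simp
qed

lemma integral_mu_T:
  fixes h :: "real \<Rightarrow> real"
  assumes f: "f \<in> H" and h: "continuous_on UNIV h"
  shows "(\<integral>x. h x \<partial>mu (T f)) = (\<integral>x. x\<^sup>2 * h x \<partial>mu f)"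
proof -
  have "mu (T f) = density (mu f) (\<lambda>x. ennreal (x\<^sup>2))"
  proof (rule measure_eqI)
    fix B assume "B \<in> sets (mu (T f))"
    then have B: "B \<in> sets borel" by simp
    have "emeasure (density (mu f) (\<lambda>x. ennreal (x\<^sup>2))) B
        = (\<integral>\<^sup>+x. ennreal (x\<^sup>2) * indicator B x \<partial>mu f)"
      using B by (intro emeasure_density) auto
    also have "\<dots> = (\<integral>\<^sup>+x. ennreal (indicator B x * x\<^sup>2) \<partial>mu f)"
      by (rule nn_integral_cong) (auto simp: indicator_def)
    also have "\<dots> = ennreal (\<integral>x. indicator B x * x\<^sup>2 \<partial>mu f)"
      using f B by (intro nn_integral_eq_integral integrable_mu) (auto intro!: continuous_intros)
    finally show "emeasure (mu (T f)) B = emeasure (density (mu f) (\<lambda>x. ennreal (x\<^sup>2))) B"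
      using f B by (simp add: emeasure_mu T_in weight_T)
  qed simp
  moreover have "h \<in> borel_measurable (mu f)"
    using borel_measurable_continuous_onI[OF h] by simp
  ultimately show ?thesis
    by (simp add: integral_density)
qed

text \<open>Two factors \<open>T\<close> are removed at a time: \<open>\<langle>f, T ^^ (k + 2) f\<rangle> = \<langle>T f, (T ^^ k) (T f)\<rangle>\<close>,
  and two powers of \<open>l\<close> pass into the measure of \<open>T f\<close>.\<close>

theorem moment:
  assumes "f \<in> H"
  shows "ip f ((T ^^ N) f) = of_real (\<integral>x. x ^ N \<partial>mu f)"
  using assms
proof (induction N arbitrary: f rule: nat_less_induct)
  case (1 N)
  note f = 1(2)
  consider "N = 0" | "N = 1" | k where "N = Suc (Suc k)"
    by (metis One_nat_def not0_implies_Suc)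
  then show ?case
  proof cases
    case 1
    have "ip f f = of_real (weight f UNIV)"
      using inner_E_self[of UNIV f] f by (simp add: E_UNIV)
    then show ?thesis
      using 1 measure_mu[OF f, of UNIV] by simp
  next
    case 2
    then show ?thesis using quadratic_form[OF f] by simp
  next
    case (3 k)
    have pow_in: "(T ^^ k) (T f) \<in> H"
      using T_in[OF f] by (induction k) (auto intro: T_in)
    have "ip f ((T ^^ N) f) = ip f (T ((T ^^ k) (T f)))"
      by (simp add: 3 funpow_swap1)
    also have "\<dots> = ip (T f) ((T ^^ k) (T f))"
      using T_symmetric[OF f pow_in] by simp
    also have "\<dots> = of_real (\<integral>x. x ^ k \<partial>mu (T f))"
      using 1(1) 3 T_in[OF f] by simp
    also have "(\<integral>x. x ^ k \<partial>mu (T f)) = (\<integral>x. x ^ N \<partial>mu f)"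
      using integral_mu_T[OF f, of "\<lambda>x. x ^ k"]
      by (simp add: 3 power2_eq_square mult.assoc continuous_intros)
    finally show ?thesis .
  qed
qed

end

section \<open>Moments of the cumulative spectral measure\<close>

context finite_walk
begin

text \<open>The cumulative spectral measure is the distribution of the eigenvalue of an eigenvector picked
  uniformly from a basis, so its \<open>N\<close>-th moment is the normalised trace of \<open>P ^^ N\<close>.\<close>

lemma cumulative_spectral_measure_moments:
  assumes nonempty: "verts G \<noteq> {}"
  shows real_distribution_cumulative: "real_distribution (cumulative_spectral_measure G)"
    and AE_cumulative: "AE x in cumulative_spectral_measure G. \<bar>x\<bar> \<le> 1"
    and moment_cumulative: "(\<integral>x. x ^ N \<partial>cumulative_spectral_measure G) = Re (mean_return G N)"
proof -
  obtain S :: "('a \<Rightarrow> complex) set" and lam where S: "finite S" "\<And>e. e \<in> S \<Longrightarrow> \<bar>lam e\<bar> \<le> 1"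
    and trace: "\<And>N. (\<Sum>e\<in>S. complex_of_real (lam e) ^ N) = (\<Sum>x\<in>verts G. (T ^^ N) (delta x) x)"
    and weights: "\<And>g. (\<Sum>l\<in>srw_spec G. real (eigen_mult G l) * g (Re l)) = (\<Sum>e\<in>S. g (lam e))"
    by (rule spectral_decomposition) blast
  have "complex_of_nat (card S) = complex_of_nat (card (verts G))"
    using trace[of 0] by (simp add: delta_def)
  then have card: "card S = card (verts G)"
    by (simp only: of_nat_eq_iff)
  then have ne: "S \<noteq> {}"
    using nonempty fin by auto
  let ?U = "uniform_count_measure S"
  let ?D = "distr ?U borel lam"
  interpret U: prob_space ?U
    using S(1) ne by (rule prob_space_uniform_count_measure)
  have lam: "lam \<in> measurable ?U borel"
    by (simp add: measurable_def sets_uniform_count_measure space_uniform_count_measure)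
  have em: "emeasure ?D B = ennreal (1 / real (card (verts G)) *
      (\<Sum>l\<in>srw_spec G. real (eigen_mult G l) * indicator B (Re l)))" if "B \<in> sets borel" for B
  proof -
    have "emeasure ?D B = emeasure ?U {e \<in> S. lam e \<in> B}"
      using that lam
      by (subst emeasure_distr) (auto simp: space_uniform_count_measure intro!: arg_cong[where f = "emeasure ?U"])
    also have "\<dots> = ennreal (real (card {e \<in> S. lam e \<in> B}) / real (card S))"
      using S(1) by (intro emeasure_uniform_count_measure) auto
    also have "real (card {e \<in> S. lam e \<in> B}) = (\<Sum>e\<in>S. indicator B (lam e))"
      using S(1) by (simp add: indicator_def of_bool_def sum.If_cases Int_def)
    finally show ?thesis
      by (simp add: weights card)
  qed
  have "cumulative_spectral_measure G = measure_of UNIV (sets borel) (emeasure ?D)"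
    unfolding cumulative_spectral_measure_def
  proof (rule measure_of_eq)
    fix B :: "real set" assume "B \<in> sigma_sets UNIV (sets borel)"
    then have "B \<in> sets borel"
      using sets.sigma_sets_eq[of "borel :: real measure"] by simp
    then show "ennreal (1 / real (card (verts G)) *
        (\<Sum>l\<in>srw_spec G. real (eigen_mult G l) * indicator B (Re l))) = emeasure ?D B"
      by (simp only: em)
  qed simp
  also have "\<dots> = ?D"
    using measure_of_of_measure[of ?D] by simp
  finally have eq: "cumulative_spectral_measure G = ?D" .
  show "real_distribution (cumulative_spectral_measure G)"
    unfolding eq using lam by (rule U.real_distribution_distr)
  show "AE x in cumulative_spectral_measure G. \<bar>x\<bar> \<le> 1"
    unfolding eq using S lam
    by (subst AE_distr_iff) (auto simp: space_uniform_count_measure intro!: AE_I2)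
  have "complex_of_real (\<integral>x. x ^ N \<partial>?D) = mean_return G N"
    using S(1) lam trace[of N]
    by (simp add: integral_distr integral_uniform_count_measure mean_return_def card)
  then show "(\<integral>x. x ^ N \<partial>cumulative_spectral_measure G) = Re (mean_return G N)"
    unfolding eq by (metis Re_complex_of_real)
qed

end

section \<open>The walk on a graph of bounded degree\<close>

lemma vertex_transitive_degree:
  assumes G: "is_graph G" "vertex_transitive G" and x: "x \<in> verts G" and y: "y \<in> verts G"
  shows "degree G x = degree G y"
proof -
  obtain \<phi> where "graph_iso \<phi> G G" and y_eq: "\<phi> x = y"
    using assms unfolding vertex_transitive_def by blast
  then have bij: "bij_betw \<phi> (verts G) (verts G)"
    and iff: "\<And>a b. a \<in> verts G \<Longrightarrow> b \<in> verts G \<Longrightarrow> (a, b) \<in> edges G \<longleftrightarrow> (\<phi> a, \<phi> b) \<in> edges G"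
    by (auto simp: graph_iso_def)
  have sub: "nbrs G z \<subseteq> verts G" for z
    using G by (auto simp: nbrs_def is_graph_def)
  have "\<phi> ` nbrs G x = nbrs G y"
  proof
    show "\<phi> ` nbrs G x \<subseteq> nbrs G y"
      using iff x sub y_eq by (auto simp: nbrs_def)
    show "nbrs G y \<subseteq> \<phi> ` nbrs G x"
    proof
      fix w assume w: "w \<in> nbrs G y"
      then have "w \<in> \<phi> ` verts G"
        using sub[of y] bij by (auto simp: bij_betw_def)
      then obtain v where "v \<in> verts G" "w = \<phi> v"
        by blast
      then show "w \<in> \<phi> ` nbrs G x"
        using w iff x y_eq by (auto simp: nbrs_def)
    qed
  qed
  moreover have "inj_on \<phi> (nbrs G x)"
    using bij sub by (auto simp: bij_betw_def intro: inj_on_subset)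
  ultimately show ?thesis
    unfolding degree_def by (metis card_image)
qed

text \<open>By Cauchy-Schwarz \<open>\<bar>P f\<bar>\<^sup>2\<close> at \<open>x\<close> is at most the sum of \<open>\<bar>f\<bar>\<^sup>2\<close> over the neighbours of
  \<open>x\<close>, and every vertex is a neighbour of at most \<open>d\<close> others.\<close>

lemma srw_op_in_ell2:
  assumes G: "is_graph G" "locally_finite G" and d: "\<And>x. x \<in> verts G \<Longrightarrow> degree G x \<le> d"
    and f: "f \<in> ell2 (verts G)"
  shows "srw_op G f \<in> ell2 (verts G)"
proof -
  let ?V = "verts G"
  have sub: "nbrs G x \<subseteq> ?V" for x
    using G by (auto simp: nbrs_def is_graph_def)
  have fin: "finite (nbrs G x)" if "x \<in> ?V" for x
    using G that by (simp add: locally_finite_def)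
  have pointwise: "(cmod (srw_op G f x))\<^sup>2 \<le> (\<Sum>y\<in>nbrs G x. (cmod (f y))\<^sup>2)" for x
  proof (cases "degree G x = 0")
    case True
    then show ?thesis by (simp add: srw_op_eq sum_nonneg)
  next
    case False
    let ?k = "real (degree G x)"
    have k: "?k \<ge> 1"
      using False by simp
    have "(cmod (\<Sum>y\<in>nbrs G x. f y))\<^sup>2 \<le> (\<Sum>y\<in>nbrs G x. 1 * cmod (f y))\<^sup>2"
      by (intro power_mono) (auto intro: norm_sum)
    also have "\<dots> \<le> (\<Sum>y\<in>nbrs G x. 1\<^sup>2) * (\<Sum>y\<in>nbrs G x. (cmod (f y))\<^sup>2)"
      by (rule Cauchy_Schwarz_ineq_sum)
    also have "\<dots> = ?k * (\<Sum>y\<in>nbrs G x. (cmod (f y))\<^sup>2)"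
      by (simp add: degree_def)
    also have "\<dots> \<le> ?k\<^sup>2 * (\<Sum>y\<in>nbrs G x. (cmod (f y))\<^sup>2)"
      using k by (intro mult_right_mono) (auto simp: power2_eq_square intro: sum_nonneg)
    finally show ?thesis
      using k by (simp add: srw_op_eq norm_divide power_divide divide_le_eq mult.commute)
  qed
  have "(\<lambda>x. (cmod (srw_op G f x))\<^sup>2) summable_on ?V"
  proof (rule nonneg_bdd_above_summable_on)
    show "bdd_above (sum (\<lambda>x. (cmod (srw_op G f x))\<^sup>2) ` {F. F \<subseteq> ?V \<and> finite F})"
    proof (rule bdd_aboveI2)
      fix F assume "F \<in> {F. F \<subseteq> ?V \<and> finite F}"
      then have F: "F \<subseteq> ?V" "finite F" by auto
      define W where "W = (\<Union>x\<in>F. nbrs G x)"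
      have W: "finite W" "W \<subseteq> ?V"
        using F fin sub by (auto simp: W_def)
      have "(\<Sum>x\<in>F. (cmod (srw_op G f x))\<^sup>2) \<le> (\<Sum>x\<in>F. \<Sum>y\<in>nbrs G x. (cmod (f y))\<^sup>2)"
        by (intro sum_mono pointwise)
      also have "\<dots> = (\<Sum>x\<in>F. \<Sum>y\<in>{y \<in> W. (x, y) \<in> edges G}. (cmod (f y))\<^sup>2)"
        by (intro sum.cong) (auto simp: W_def nbrs_def)
      also have "\<dots> = (\<Sum>y\<in>W. \<Sum>x\<in>{x \<in> F. (x, y) \<in> edges G}. (cmod (f y))\<^sup>2)"
        by (rule sum.swap_restrict[OF F(2) W(1)])
      also have "\<dots> \<le> (\<Sum>y\<in>W. real d * (cmod (f y))\<^sup>2)"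
      proof (rule sum_mono)
        fix y assume "y \<in> W"
        then have y: "y \<in> ?V" using W by auto
        have "{x \<in> F. (x, y) \<in> edges G} \<subseteq> nbrs G y"
          using G by (auto simp: nbrs_def is_graph_def dest: symD)
        then have "card {x \<in> F. (x, y) \<in> edges G} \<le> degree G y"
          unfolding degree_def by (rule card_mono[OF fin[OF y]])
        also have "\<dots> \<le> d"
          using y by (rule d)
        finally show "(\<Sum>x\<in>{x \<in> F. (x, y) \<in> edges G}. (cmod (f y))\<^sup>2) \<le> real d * (cmod (f y))\<^sup>2"
          by (simp add: mult_right_mono)
      qed
      also have "\<dots> = real d * (\<Sum>y\<in>W. (cmod (f y))\<^sup>2)"
        by (simp add: sum_distrib_left)
      also have "\<dots> \<le> real d * (\<Sum>\<^sub>\<infinity>y\<in>?V. (cmod (f y))\<^sup>2)"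
        using finite_sum_le_infsum[OF ell2_summable[OF f] W] by (intro mult_left_mono) auto
      finally show "(\<Sum>x\<in>F. (cmod (srw_op G f x))\<^sup>2) \<le> real d * (\<Sum>\<^sub>\<infinity>y\<in>?V. (cmod (f y))\<^sup>2)" .
    qed
  qed simp
  moreover have "srw_op G f x = 0" if "x \<notin> ?V" for x
  proof -
    have "nbrs G x = {}"
      using G that by (auto simp: nbrs_def is_graph_def)
    then show ?thesis by (simp add: srw_op_eq)
  qed
  ultimately show ?thesis
    by (simp add: ell2_def)
qed

section \<open>Convergence of the spectral measures\<close>

theorem mainTheorem6:
  fixes X :: "'a graph" and root :: 'a
    and Xs :: "nat \<Rightarrow> 'b graph" and roots :: "nat \<Rightarrow> 'b"
    and E :: "real set \<Rightarrow> ('a \<Rightarrow> complex) \<Rightarrow> ('a \<Rightarrow> complex)"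
  assumes "is_graph X" and "infinite (verts X)" and "connected_graph X"
    and "locally_finite X" and "vertex_transitive X" and "root \<in> verts X"
    and "\<And>n. is_graph (Xs n)" and "\<And>n. finite (verts (Xs n))"
    and "\<And>n. no_isolated (Xs n)" and "\<And>n. roots n \<in> verts (Xs n)"
    and "rooted_converges Xs roots X root"
    and "foelner_approximation Xs X root"
    and "resolution_of_identity (verts X) (srw_op X) E"
  shows "weak_conv_m (\<lambda>n. cumulative_spectral_measure (Xs n)) (plancherel_measure X E root)"
proof -
  note X = assms(1) and root = assms(6)
  have fw: "finite_walk (Xs n)" for n
    using assms(7-9) by unfold_locales
  have ne: "verts (Xs n) \<noteq> {}" for n
    using assms(10) by blast
  interpret spectral_resolution "verts X" "srw_op X" E
  proof
    show "srw_op X f \<in> ell2 (verts X)" if "f \<in> ell2 (verts X)" for f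
      using X assms(4) that vertex_transitive_degree[OF X assms(5) _ root]
      by (intro srw_op_in_ell2[of X "degree X root"]) auto
  qed (use assms(13) in \<open>simp_all only: srw_op_add srw_op_fscale\<close>)
  have d: "delta root \<in> ell2 (verts X)"
    using root by (rule delta_in_ell2)
  have mu: "plancherel_measure X E root = mu (delta root)"
    by (simp add: plancherel_measure_def)
  have "weight (delta root) UNIV = 1"
    using d root by (simp add: weight_def E_UNIV ell2_inner_delta) (simp add: delta_def)
  then have "prob_space (mu (delta root))"
    using d by (intro prob_spaceI) (simp add: emeasure_mu)
  then have dist: "real_distribution (mu (delta root))"
    by (simp add: real_distribution_def real_distribution_axioms_def)
  obtain a where a: "a \<ge> 1" "\<And>f. f \<in> ell2 (verts X) \<Longrightarrow> AE x in mu f. \<bar>x\<bar> \<le> a"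
    using bounded_support by blast
  show ?thesis
    unfolding mu
  proof (rule moments_tendsto_imp_weak_conv_m[OF _ dist _ a(2)[OF d]])
    fix n N
    show "real_distribution (cumulative_spectral_measure (Xs n))"
      using finite_walk.real_distribution_cumulative[OF fw ne] .
    show "AE x in cumulative_spectral_measure (Xs n). \<bar>x\<bar> \<le> a"
      using finite_walk.AE_cumulative[OF fw ne] by eventually_elim (use a(1) in simp)
    have "complex_of_real (\<integral>x. x ^ N \<partial>mu (delta root)) = (srw_op X ^^ N) (delta root) root"
      using moment[OF d] root by (simp add: ell2_inner_delta)
    then have "(\<lambda>n. Re (mean_return (Xs n) N)) \<longlonglongrightarrow> Re (complex_of_real (\<integral>x. x ^ N \<partial>mu (delta root)))"
      using mean_return_tendsto[OF X root assms(12,7,8) ne, of N] by (intro tendsto_Re) simp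
    then show "(\<lambda>n. \<integral>x. x ^ N \<partial>cumulative_spectral_measure (Xs n)) \<longlonglongrightarrow> (\<integral>x. x ^ N \<partial>mu (delta root))"
      by (simp only: finite_walk.moment_cumulative[OF fw ne] Re_complex_of_real)
  qed
qed

end
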